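(* There exist $\mathbb{K}\in\{\mathbb{R},\mathbb{C}\}$, Hilbert spaces $V$ and $H$ over $\mathbb{K}$ such that $V$ is continuously and densely embedded in $H$, a number $T>0$, and a coercive non-autonomous form $\mathfrak{a}\colon[0,T]\times V\times V\to\mathbb{K}$ such that $\mathfrak{a}$ does not satisfy maximal regularity in $H$.
   Context: Let $V,H$ be Hilbert spaces over $\mathbb{K}$ ($\mathbb{R}$ or $\mathbb{C}$) with $V$ continuously and densely embedded in $H$. Let $V'$ denote the dual of $V$ (antidual, i.e. the continuous antilinear functionals, if $\mathbb{K}=\mathbb{C}$). Identify $h\in H$ with the functional $(h\,|\,\cdot)_H\in V'$, so that $V\hookrightarrow H\hookrightarrow V'$. Let $T>0$. A non-autonomous form is a map $\mathfrak{a}\colon[0,T]\times V\times V\to\mathbb{K}$ such that $\mathfrak{a}(t,\cdot,\cdot)$ is sesquilinear for each $t\in[0,T]$, $\mathfrak{a}(\cdot,v,w)$ is measurable for all $v,w\in V$, and there is $M\ge 0$ with $|\mathfrak{a}(t,v,w)|\le M\|v\|_V\|w\|_V$ for all $t\in[0,T]$, $v,w\in V$. It is coercive if there is $\alpha>0$ with $\operatorname{Re}\mathfrak{a}(t,v,v)\ge\alpha\|v\|_V^2$ for all $t\in[0,T]$, $v\in V$. The associated operators $\mathcal{A}(t)\in\mathcal{L}(V,V')$ are given by $\mathcal{A}(t)v=\mathfrak{a}(t,v,\cdot)$. Let $MR(V,V')=L^2(0,T;V)\cap H^1(0,T;V')$, which embeds continuously in $C([0,T];H)$. By a theorem of Lions,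 for a coercive non-autonomous form and every $u_0\in H$, $f\in L^2(0,T;V')$ there is a unique $u\in MR(V,V')$ with $u'(t)+\mathcal{A}(t)u(t)=f(t)$ in $V'$ for almost every $t\in[0,T]$ and $u(0)=u_0$. A coercive non-autonomous form $\mathfrak{a}$ satisfies maximal regularity in $H$ if for $u_0=0$ and every $f\in L^2(0,T;H)$ this unique solution $u\in MR(V,V')$ belongs to $H^1(0,T;H)$. *)

theory Defs
  imports "HOL-Analysis.Analysis" "HOL-Algebra.Module"
begin

section \<open>Hilbert spaces over the real or complex numbers, and antiduals\<close>

text \<open>
  Since HOL cannot quantify existentially over types, vector spaces are modules in the sense of
  HOL-Algebra, that is, structures with an explicit carrier; the components \<open>mult\<close> and \<open>one\<close>, which
  every module record inherits from rings, play no role. The scalar field is a set of complex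
  numbers: \<open>\<real>\<close> for real spaces, \<open>UNIV\<close> for complex ones. On \<open>\<real>\<close> complex conjugation is the
  identity, so that antilinear and sesquilinear mean linear and bilinear there.
\<close>

definition scalar_ring :: "complex set \<Rightarrow> complex ring" where
  "scalar_ring K = \<lparr>carrier = K, monoid.mult = (*), one = 1, ring.zero = 0, add = (+)\<rparr>"

record 'a normed = "(complex, 'a) module" +
  nrm :: "'a \<Rightarrow> real"

record 'a hilbert = "'a normed" +
  ip :: "'a \<Rightarrow> 'a \<Rightarrow> complex"

text \<open>
  The locale \<open>Metric_space\<close> wants a nonnegative symmetric function on the whole type, hence the
  value 0 off the carrier.
\<close>

definition ndist :: "('a, 'm) normed_scheme \<Rightarrow> 'a \<Rightarrow> 'a \<Rightarrow> real" where
  "ndist X x y = (if x \<in> carrier X \<and> y \<in> carrier X then nrm X (x \<ominus>\<^bsub>X\<^esub> y) else 0)"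

abbreviation ntop :: "('a, 'm) normed_scheme \<Rightarrow> 'a topology" where
  "ntop X \<equiv> Metric_space.mtopology (carrier X) (ndist X)"

locale hilbert_space =
  fixes K :: "complex set" and X :: "('a, 'm) hilbert_scheme" (structure)
  assumes scalars: "K \<in> {\<real>, UNIV}"
    and vector_space: "module (scalar_ring K) X"
    and ip_closed: "\<lbrakk>x \<in> carrier X; y \<in> carrier X\<rbrakk> \<Longrightarrow> ip X x y \<in> K"
    and ip_add_left: "\<lbrakk>x \<in> carrier X; y \<in> carrier X; z \<in> carrier X\<rbrakk>
      \<Longrightarrow> ip X (x \<oplus> y) z = ip X x z + ip X y z"
    and ip_smult_left: "\<lbrakk>c \<in> K; x \<in> carrier X; y \<in> carrier X\<rbrakk>
      \<Longrightarrow> ip X (c \<odot>\<^bsub>X\<^esub> x) y = c * ip X x y"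
    and ip_cnj: "\<lbrakk>x \<in> carrier X; y \<in> carrier X\<rbrakk> \<Longrightarrow> ip X y x = cnj (ip X x y)"
    and ip_pos: "\<lbrakk>x \<in> carrier X; x \<noteq> \<zero>\<rbrakk> \<Longrightarrow> 0 < Re (ip X x x)"
    and nrm_ip: "x \<in> carrier X \<Longrightarrow> nrm X x = sqrt (Re (ip X x x))"
    and complete: "Metric_space.mcomplete (carrier X) (ndist X)"

definition antilinear_on :: "complex set \<Rightarrow> ('a, 'm) normed_scheme \<Rightarrow> ('a \<Rightarrow> complex) \<Rightarrow> bool" where
  "antilinear_on K V \<phi> \<longleftrightarrow>
     (\<forall>v\<in>carrier V. \<forall>w\<in>carrier V. \<phi> (v \<oplus>\<^bsub>V\<^esub> w) = \<phi> v + \<phi> w) \<and>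
     (\<forall>c\<in>K. \<forall>v\<in>carrier V. \<phi> (c \<odot>\<^bsub>V\<^esub> v) = cnj c * \<phi> v)"

definition antidual :: "complex set \<Rightarrow> ('a, 'm) normed_scheme \<Rightarrow> ('a \<Rightarrow> complex) normed" where
  "antidual K V =
    \<lparr>carrier = {\<phi> \<in> carrier V \<rightarrow>\<^sub>E K. antilinear_on K V \<phi> \<and>
                  (\<exists>C. \<forall>v\<in>carrier V. cmod (\<phi> v) \<le> C * nrm V v)},
     monoid.mult = undefined, one = undefined,
     ring.zero = (\<lambda>v\<in>carrier V. 0),
     add = (\<lambda>\<phi> \<psi>. \<lambda>v\<in>carrier V. \<phi> v + \<psi> v),
     smult = (\<lambda>c \<phi>. \<lambda>v\<in>carrier V. c * \<phi> v),
     nrm = (\<lambda>\<phi>. SUP v\<in>{v \<in> carrier V. nrm V v \<le> 1}. cmod (\<phi> v))\<rparr>"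

definition dense_embedding ::
    "complex set \<Rightarrow> ('a, 'm) hilbert_scheme \<Rightarrow> ('b, 'n) hilbert_scheme \<Rightarrow> ('a \<Rightarrow> 'b) \<Rightarrow> bool" where
  "dense_embedding K V H j \<longleftrightarrow>
     j \<in> carrier V \<rightarrow> carrier H \<and>
     (\<forall>v\<in>carrier V. \<forall>w\<in>carrier V. j (v \<oplus>\<^bsub>V\<^esub> w) = j v \<oplus>\<^bsub>H\<^esub> j w) \<and>
     (\<forall>c\<in>K. \<forall>v\<in>carrier V. j (c \<odot>\<^bsub>V\<^esub> v) = c \<odot>\<^bsub>H\<^esub> j v) \<and>
     inj_on j (carrier V) \<and>
     continuous_map (ntop V) (ntop H) j \<and>
     ntop H closure_of (j ` carrier V) = carrier H"

text \<open>The identification of \<open>h \<in> H\<close> with the functional \<open>(h | \<cdot>)\<^sub>H\<close> on \<open>V\<close>.\<close>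

definition to_antidual ::
    "('a, 'm) hilbert_scheme \<Rightarrow> ('b, 'n) hilbert_scheme \<Rightarrow> ('a \<Rightarrow> 'b) \<Rightarrow> 'b \<Rightarrow> ('a \<Rightarrow> complex)" where
  "to_antidual V H j h = (\<lambda>v\<in>carrier V. ip H h (j v))"


section \<open>Bochner integration and Sobolev spaces of vector-valued functions\<close>

text \<open>
  The Bochner integral of the library lives on type classes. The following notions repeat its
  definition for structures with a carrier.
\<close>

definition carrier_simple :: "'s measure \<Rightarrow> ('a, 'm) normed_scheme \<Rightarrow> ('s \<Rightarrow> 'a) \<Rightarrow> bool" where
  "carrier_simple M X s \<longleftrightarrow> simple_function M s \<and> s \<in> space M \<rightarrow> carrier X"

definition strongly_measurable :: "'s measure \<Rightarrow> ('a, 'm) normed_scheme \<Rightarrow> ('s \<Rightarrow> 'a) \<Rightarrow> bool" where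
  "strongly_measurable M X f \<longleftrightarrow>
     f \<in> space M \<rightarrow> carrier X \<and>
     (\<exists>s. (\<forall>i. carrier_simple M X (s i)) \<and>
          (AE t in M. limitin (ntop X) (\<lambda>i. s i t) (f t) sequentially))"

definition simple_integral ::
    "'s measure \<Rightarrow> ('a, 'm) normed_scheme \<Rightarrow> ('s \<Rightarrow> 'a) \<Rightarrow> 'a" where
  "simple_integral M X s =
     finsum X (\<lambda>x. of_real (measure M (s -` {x} \<inter> space M)) \<odot>\<^bsub>X\<^esub> x) (s ` space M)"

text \<open>Only used for finite measures \<open>M\<close>, where every simple function is integrable.\<close>

definition has_carrier_integral ::
    "'s measure \<Rightarrow> ('a, 'm) normed_scheme \<Rightarrow> ('s \<Rightarrow> 'a) \<Rightarrow> 'a \<Rightarrow> bool" where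
  "has_carrier_integral M X f x \<longleftrightarrow>
     strongly_measurable M X f \<and>
     (\<exists>s. (\<forall>i. carrier_simple M X (s i)) \<and>
          (\<lambda>i. \<integral>\<^sup>+t. ennreal (nrm X (f t \<ominus>\<^bsub>X\<^esub> s i t)) \<partial>M) \<longlonglongrightarrow> 0 \<and>
          limitin (ntop X) (\<lambda>i. simple_integral M X (s i)) x sequentially)"

abbreviation interval_measure :: "real \<Rightarrow> real measure" where
  "interval_measure T \<equiv> lebesgue_on {0..T}"

definition L2 :: "real \<Rightarrow> ('a, 'm) normed_scheme \<Rightarrow> (real \<Rightarrow> 'a) set" where
  "L2 T X = {u. strongly_measurable (interval_measure T) X u \<and>
                integrable (interval_measure T) (\<lambda>t. (nrm X (u t))\<^sup>2)}"

definition test_function :: "real \<Rightarrow> (real \<Rightarrow> real) \<Rightarrow> bool" where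
  "test_function T \<phi> \<longleftrightarrow>
     (\<forall>n t. (deriv ^^ n) \<phi> differentiable (at t)) \<and>
     compact (closure {t. \<phi> t \<noteq> 0}) \<and> closure {t. \<phi> t \<noteq> 0} \<subseteq> {0<..<T}"

definition weak_derivative ::
    "real \<Rightarrow> ('a, 'm) normed_scheme \<Rightarrow> (real \<Rightarrow> 'a) \<Rightarrow> (real \<Rightarrow> 'a) \<Rightarrow> bool" where
  "weak_derivative T X u g \<longleftrightarrow>
     (\<forall>\<phi>. test_function T \<phi> \<longrightarrow>
        (\<exists>y\<in>carrier X.
           has_carrier_integral (interval_measure T) X
             (\<lambda>t. of_real (deriv \<phi> t) \<odot>\<^bsub>X\<^esub> u t) (\<ominus>\<^bsub>X\<^esub> y) \<and>
           has_carrier_integral (interval_measure T) X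
             (\<lambda>t. of_real (\<phi> t) \<odot>\<^bsub>X\<^esub> g t) y))"

definition H1 :: "real \<Rightarrow> ('a, 'm) normed_scheme \<Rightarrow> (real \<Rightarrow> 'a) set" where
  "H1 T X = {u \<in> L2 T X. \<exists>g\<in>L2 T X. weak_derivative T X u g}"


section \<open>Non-autonomous forms and maximal regularity\<close>

definition nonautonomous_form ::
    "complex set \<Rightarrow> real \<Rightarrow> ('a, 'm) hilbert_scheme \<Rightarrow> (real \<Rightarrow> 'a \<Rightarrow> 'a \<Rightarrow> complex) \<Rightarrow> bool" where
  "nonautonomous_form K T V a \<longleftrightarrow>
     (\<forall>t\<in>{0..T}. \<forall>v\<in>carrier V. \<forall>w\<in>carrier V. a t v w \<in> K) \<and>
     (\<forall>t\<in>{0..T}. \<forall>w\<in>carrier V.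
        (\<forall>u\<in>carrier V. \<forall>v\<in>carrier V. a t (u \<oplus>\<^bsub>V\<^esub> v) w = a t u w + a t v w) \<and>
        (\<forall>c\<in>K. \<forall>v\<in>carrier V. a t (c \<odot>\<^bsub>V\<^esub> v) w = c * a t v w)) \<and>
     (\<forall>t\<in>{0..T}. \<forall>v\<in>carrier V. antilinear_on K V (a t v)) \<and>
     (\<forall>v\<in>carrier V. \<forall>w\<in>carrier V. (\<lambda>t. a t v w) \<in> borel_measurable (interval_measure T)) \<and>
     (\<exists>M\<ge>0. \<forall>t\<in>{0..T}. \<forall>v\<in>carrier V. \<forall>w\<in>carrier V. cmod (a t v w) \<le> M * nrm V v * nrm V w)"

definition coercive_form ::
    "real \<Rightarrow> ('a, 'm) hilbert_scheme \<Rightarrow> (real \<Rightarrow> 'a \<Rightarrow> 'a \<Rightarrow> complex) \<Rightarrow> bool" where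
  "coercive_form T V a \<longleftrightarrow>
     (\<exists>\<alpha>>0. \<forall>t\<in>{0..T}. \<forall>v\<in>carrier V. Re (a t v v) \<ge> \<alpha> * (nrm V v)\<^sup>2)"

definition form_operator ::
    "('a, 'm) hilbert_scheme \<Rightarrow> (real \<Rightarrow> 'a \<Rightarrow> 'a \<Rightarrow> complex) \<Rightarrow> real \<Rightarrow> 'a \<Rightarrow> ('a \<Rightarrow> complex)" where
  "form_operator V a t v = (\<lambda>w\<in>carrier V. a t v w)"

definition MR ::
    "complex set \<Rightarrow> real \<Rightarrow> ('a, 'm) hilbert_scheme \<Rightarrow> ('b, 'n) hilbert_scheme \<Rightarrow> ('a \<Rightarrow> 'b)
      \<Rightarrow> (real \<Rightarrow> 'a) set" where
  "MR K T V H j = {u \<in> L2 T V. (\<lambda>t. to_antidual V H j (j (u t))) \<in> H1 T (antidual K V)}"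

text \<open>
  Elements of \<open>MR K T V H j\<close> are only determined almost everywhere; the initial value is that of
  the continuous representative with values in \<open>H\<close>.
\<close>

definition initial_value ::
    "real \<Rightarrow> ('b, 'n) hilbert_scheme \<Rightarrow> (real \<Rightarrow> 'b) \<Rightarrow> 'b \<Rightarrow> bool" where
  "initial_value T H u h \<longleftrightarrow>
     (\<exists>v. continuous_map (top_of_set {0..T}) (ntop H) v \<and>
          (AE t in interval_measure T. v t = u t) \<and> v 0 = h)"

definition solves_Cauchy_problem ::
    "complex set \<Rightarrow> real \<Rightarrow> ('a, 'm) hilbert_scheme \<Rightarrow> ('b, 'n) hilbert_scheme \<Rightarrow> ('a \<Rightarrow> 'b)
      \<Rightarrow> (real \<Rightarrow> 'a \<Rightarrow> 'a \<Rightarrow> complex) \<Rightarrow> (real \<Rightarrow> ('a \<Rightarrow> complex)) \<Rightarrow> 'b \<Rightarrow> (real \<Rightarrow> 'a) \<Rightarrow> bool" where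
  "solves_Cauchy_problem K T V H j a f u\<^sub>0 u \<longleftrightarrow>
     u \<in> MR K T V H j \<and>
     (\<exists>u'\<in>L2 T (antidual K V).
        weak_derivative T (antidual K V) (\<lambda>t. to_antidual V H j (j (u t))) u' \<and>
        (AE t in interval_measure T.
           u' t \<oplus>\<^bsub>antidual K V\<^esub> form_operator V a t (u t) = f t)) \<and>
     initial_value T H (\<lambda>t. j (u t)) u\<^sub>0"

text \<open>
  The solution is unique by Lions' theorem (up to null sets, which affect none of the conditions),
  so a property of the solution is stated for all solutions. The negation of
  \<open>maximal_regularity\<close> provides a solution that is not in \<open>H1 T H\<close>.
\<close>

definition maximal_regularity ::
    "complex set \<Rightarrow> real \<Rightarrow> ('a, 'm) hilbert_scheme \<Rightarrow> ('b, 'n) hilbert_scheme \<Rightarrow> ('a \<Rightarrow> 'b)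
      \<Rightarrow> (real \<Rightarrow> 'a \<Rightarrow> 'a \<Rightarrow> complex) \<Rightarrow> bool" where
  "maximal_regularity K T V H j a \<longleftrightarrow>
     (\<forall>f\<in>L2 T H. \<forall>u.
        solves_Cauchy_problem K T V H j a (\<lambda>t. to_antidual V H j (f t)) \<zero>\<^bsub>H\<^esub> u
          \<longrightarrow> (\<lambda>t. j (u t)) \<in> H1 T H)"

end

theory Submission
  imports Defs
begin

text \<open>
  The idea is to prescribe the solution and to find the form afterwards. Let \<open>V\<close> and \<open>H\<close> be
  weighted sequence spaces, written as two copies of \<open>ell2\<close> that are linked by the diagonal
  embedding \<open>emb x n = x n / 2 ^ n\<close>. In the coordinates of \<open>V\<close>, the functional that belongs to
  \<open>h \<in> H\<close> has the Riesz representative \<open>emb h\<close>, so that \<open>u \<in> V\<close> is represented in \<open>V'\<close> by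
  \<open>emb (emb u) n = u n / 4 ^ n\<close>.

  The curve \<open>wave t n = cis (4 ^ n * t) / 2 ^ n\<close> (\<open>n > 0\<close>) is bounded in \<open>V\<close>, and its derivative in
  \<open>V'\<close> has the representative \<open>\<i> * wave t\<close>, hence is bounded in \<open>V'\<close>. In \<open>H\<close>, however, the
  coordinates of the derivative are \<open>\<i> * cis (4 ^ n * t)\<close>, which all have modulus 1. The
  unit vector \<open>e0\<close> is added to this curve in order to obtain coercivity, and a factor \<open>t\<close>
  produces the initial value 0: the solution is to be \<open>u t = t * (e0 + wave t)\<close>.

  It remains to find operators that send \<open>e0 + wave t\<close> to \<open>e0 - \<i> * wave t\<close>, up to terms in
  \<open>H\<close>. A perturbation of rank one of the Riesz map does this:
  \<open>form t x y = (x | y) - (1 + \<i>) * x 0 * (wave t | y)\<close>. It is coercive because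
  \<open>cmod (1 + \<i>) * nrm (wave t) = sqrt (2/3) < 1\<close>. The terms \<open>t * \<i> * wave t\<close> of \<open>u'\<close> and of
  \<open>\<A> u\<close> cancel, and what is left is represented by an element of \<open>H\<close> that depends continuously
  on \<open>t\<close> (\<open>sol_equation\<close>).

  To see that \<open>u\<close> has no weak derivative \<open>g\<close> in \<open>L\<^sup>2(0,1;H)\<close>, a test function
  \<open>bump t * cis (- (4 ^ n * t))\<close> is applied to the \<open>n\<close>-th coordinate. It turns the coordinate of the
  derivative into \<open>bump t * (1 / 4 ^ n + \<i> * t)\<close>, whose integral has a fixed positive imaginary
  part, whereas the integrals of \<open>cmod (g t n)\<close> tend to 0 (\<open>sol_not_H1\<close>).

  All curves that have to be integrated have continuous coordinates and a square-summable bound on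
  the coordinates that does not depend on \<open>t\<close>. Step functions approximate such a curve, its integral
  can be computed coordinatewise, and coordinatewise derivatives are weak derivatives by integration
  by parts. The Riesz isometry carries these facts over to \<open>V'\<close>.
\<close>


section \<open>Normed groups and isometries\<close>

locale normed_group = abelian_group X for X :: "('a, 'm) normed_scheme" (structure) +
  assumes nrm_eq_0_iff: "x \<in> carrier X \<Longrightarrow> nrm X x = 0 \<longleftrightarrow> x = \<zero>"
    and nrm_minus: "x \<in> carrier X \<Longrightarrow> nrm X (\<ominus> x) = nrm X x"
    and nrm_triangle: "\<lbrakk>x \<in> carrier X; y \<in> carrier X\<rbrakk> \<Longrightarrow> nrm X (x \<oplus> y) \<le> nrm X x + nrm X y"
begin

lemma nrm_nonneg: "x \<in> carrier X \<Longrightarrow> 0 \<le> nrm X x"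
  using nrm_triangle[of x "\<ominus> x"] nrm_minus[of x] nrm_eq_0_iff[of \<zero>] by (simp add: r_neg)

sublocale metric: Metric_space "carrier X" "ndist X"
proof
  fix x y z
  show "0 \<le> ndist X x y"
    by (simp add: ndist_def nrm_nonneg)
  show "ndist X x y = ndist X y x"
    using nrm_minus[of "x \<ominus> y"] by (auto simp: ndist_def a_minus_def minus_add a_comm)
  assume x: "x \<in> carrier X" and y: "y \<in> carrier X"
  show "ndist X x y = 0 \<longleftrightarrow> x = y"
    using x y by (auto simp: ndist_def nrm_eq_0_iff a_minus_def r_neg) (metis a_inv_closed minus_equality minus_minus)
  assume z: "z \<in> carrier X"
  have "(x \<ominus> y) \<oplus> (y \<ominus> z) = x \<ominus> z"
    using x y z by (simp add: a_minus_def a_assoc r_neg1)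
  then show "ndist X x z \<le> ndist X x y + ndist X y z"
    using x y z nrm_triangle[of "x \<ominus> y" "y \<ominus> z"] by (simp add: ndist_def)
qed

lemma limitin_iff:
  assumes "l \<in> carrier X" "\<And>i. f i \<in> carrier X"
  shows "limitin (ntop X) f l F \<longleftrightarrow> ((\<lambda>i. nrm X (f i \<ominus> l)) \<longlongrightarrow> 0) F"
  using assms by (simp add: metric.limitin_metric_dist_null ndist_def)

end

text \<open>
  The vehicle that brings strong measurability, integrals and weak derivatives from \<open>ell2\<close> to the
  antidual: all of them are defined by limits of simple functions, which a linear isometry preserves.
\<close>

locale isometry = X: normed_group X + Y: normed_group Y
  for X :: "('a, 'm) normed_scheme" and Y :: "('b, 'n) normed_scheme" +
  fixes R :: "'a \<Rightarrow> 'b"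
  assumes R_closed: "x \<in> carrier X \<Longrightarrow> R x \<in> carrier Y"
    and R_add: "\<lbrakk>x \<in> carrier X; y \<in> carrier X\<rbrakk> \<Longrightarrow> R (x \<oplus>\<^bsub>X\<^esub> y) = R x \<oplus>\<^bsub>Y\<^esub> R y"
    and smult_closed: "x \<in> carrier X \<Longrightarrow> complex_of_real r \<odot>\<^bsub>X\<^esub> x \<in> carrier X"
    and R_smult: "x \<in> carrier X \<Longrightarrow> R (complex_of_real r \<odot>\<^bsub>X\<^esub> x) = complex_of_real r \<odot>\<^bsub>Y\<^esub> R x"
    and nrm_R: "x \<in> carrier X \<Longrightarrow> nrm Y (R x) = nrm X x"
begin

lemma R_zero: "R \<zero>\<^bsub>X\<^esub> = \<zero>\<^bsub>Y\<^esub>"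
  using nrm_R[of "\<zero>\<^bsub>X\<^esub>"] X.nrm_eq_0_iff[of "\<zero>\<^bsub>X\<^esub>"] Y.nrm_eq_0_iff[OF R_closed[of "\<zero>\<^bsub>X\<^esub>"]] by simp

lemma R_minus: "x \<in> carrier X \<Longrightarrow> R (\<ominus>\<^bsub>X\<^esub> x) = \<ominus>\<^bsub>Y\<^esub> R x"
  using R_add[of "\<ominus>\<^bsub>X\<^esub> x" x] by (simp add: Y.minus_equality R_closed R_zero X.l_neg)

lemma R_diff: "\<lbrakk>x \<in> carrier X; y \<in> carrier X\<rbrakk> \<Longrightarrow> R (x \<ominus>\<^bsub>X\<^esub> y) = R x \<ominus>\<^bsub>Y\<^esub> R y"
  by (simp add: a_minus_def R_add R_minus)

lemma inj_R: "inj_on R (carrier X)"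
proof (rule inj_onI)
  fix x y assume xy: "x \<in> carrier X" "y \<in> carrier X" "R x = R y"
  then have "nrm X (x \<ominus>\<^bsub>X\<^esub> y) = 0"
    using nrm_R[of "x \<ominus>\<^bsub>X\<^esub> y"] Y.nrm_eq_0_iff[of "\<zero>\<^bsub>Y\<^esub>"]
    by (simp add: R_diff R_closed a_minus_def[of Y] Y.r_neg)
  then show "x = y" using xy X.metric.zero[of x y] by (simp add: ndist_def)
qed

lemma limitin_R:
  assumes "limitin (ntop X) f l F" "\<And>i. f i \<in> carrier X"
  shows "limitin (ntop Y) (\<lambda>i. R (f i)) (R l) F"
proof -
  have l: "l \<in> carrier X" using assms(1) X.metric.limitin_mspace by blast
  show ?thesis
    using assms l by (simp add: X.limitin_iff Y.limitin_iff R_closed nrm_R flip: R_diff)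
qed

lemma carrier_simple_R: "carrier_simple M X s \<Longrightarrow> carrier_simple M Y (\<lambda>t. R (s t))"
  by (auto simp: carrier_simple_def R_closed simple_function_compose1 Pi_def)

lemma strongly_measurable_R:
  assumes "strongly_measurable M X f"
  shows "strongly_measurable M Y (\<lambda>t. R (f t))"
proof -
  from assms obtain s where f: "f \<in> space M \<rightarrow> carrier X" and s: "\<And>i. carrier_simple M X (s i)"
    and lim: "AE t in M. limitin (ntop X) (\<lambda>i. s i t) (f t) sequentially"
    by (auto simp: strongly_measurable_def)
  have "AE t in M. limitin (ntop Y) (\<lambda>i. R (s i t)) (R (f t)) sequentially"
    using lim AE_space
  proof eventually_elim
    case (elim t)
    then show ?case using s by (intro limitin_R) (auto simp: carrier_simple_def Pi_def)
  qed
  then show ?thesis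
    unfolding strongly_measurable_def using f s
    by (auto simp: R_closed Pi_def intro!: exI[of _ "\<lambda>i t. R (s i t)"] carrier_simple_R)
qed

lemma finsum_R:
  assumes "finite A" "g \<in> A \<rightarrow> carrier X"
  shows "finsum Y (\<lambda>a. R (g a)) A = R (finsum X g A)"
  using assms
proof (induction rule: finite_induct)
  case (insert a A)
  then show ?case
    using X.finsum_closed[of g A] by (auto simp: X.finsum_insert Y.finsum_insert R_add R_closed Pi_def)
qed (simp add: R_zero)

lemma simple_integral_R:
  assumes s: "carrier_simple M X s"
  shows "simple_integral M Y (\<lambda>t. R (s t)) = R (simple_integral M X s)"
proof -
  have sc: "s \<in> space M \<rightarrow> carrier X" and fin: "finite (s ` space M)"
    using s by (auto simp: carrier_simple_def simple_function_def)
  have sub: "s ` space M \<subseteq> carrier X" using sc by auto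
  let ?m = "\<lambda>x. complex_of_real (measure M (s -` {x} \<inter> space M))"
  let ?m' = "\<lambda>y. complex_of_real (measure M ((\<lambda>t. R (s t)) -` {y} \<inter> space M))"
  have pre: "(\<lambda>t. R (s t)) -` {R x} \<inter> space M = s -` {x} \<inter> space M" if "x \<in> s ` space M" for x
    using that sc inj_onD[OF inj_R] by (auto simp: Pi_def)
  have "simple_integral M Y (\<lambda>t. R (s t)) = finsum Y (\<lambda>y. ?m' y \<odot>\<^bsub>Y\<^esub> y) (R ` s ` space M)"
    by (simp add: simple_integral_def image_image)
  also have "\<dots> = finsum Y (\<lambda>x. ?m' (R x) \<odot>\<^bsub>Y\<^esub> R x) (s ` space M)"
  proof (rule Y.finsum_reindex)
    show "(\<lambda>y. ?m' y \<odot>\<^bsub>Y\<^esub> y) \<in> R ` s ` space M \<rightarrow> carrier Y"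
      using sc by (auto simp: Pi_def smult_closed R_closed simp flip: R_smult)
    show "inj_on R (s ` space M)" using inj_R sub by (rule inj_on_subset)
  qed
  also have "\<dots> = finsum Y (\<lambda>x. R (?m x \<odot>\<^bsub>X\<^esub> x)) (s ` space M)"
    by (rule Y.finsum_cong') (use sub in \<open>auto simp: R_smult pre R_closed smult_closed simp flip: R_smult\<close>)
  also have "\<dots> = R (finsum X (\<lambda>x. ?m x \<odot>\<^bsub>X\<^esub> x) (s ` space M))"
    using sub by (intro finsum_R fin) (auto simp: smult_closed)
  finally show ?thesis by (simp add: simple_integral_def)
qed

lemma has_carrier_integral_R:
  assumes "has_carrier_integral M X f x"
  shows "has_carrier_integral M Y (\<lambda>t. R (f t)) (R x)"
proof -
  from assms obtain s where f: "strongly_measurable M X f" and s: "\<And>i. carrier_simple M X (s i)"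
    and lim: "(\<lambda>i. \<integral>\<^sup>+t. ennreal (nrm X (f t \<ominus>\<^bsub>X\<^esub> s i t)) \<partial>M) \<longlonglongrightarrow> 0"
    and x: "limitin (ntop X) (\<lambda>i. simple_integral M X (s i)) x sequentially"
    by (auto simp: has_carrier_integral_def)
  have fc: "f t \<in> carrier X" "s i t \<in> carrier X" if "t \<in> space M" for t i
    using f s that by (auto simp: strongly_measurable_def carrier_simple_def)
  have "(\<integral>\<^sup>+t. ennreal (nrm Y (R (f t) \<ominus>\<^bsub>Y\<^esub> R (s i t))) \<partial>M)
      = (\<integral>\<^sup>+t. ennreal (nrm X (f t \<ominus>\<^bsub>X\<^esub> s i t)) \<partial>M)" for i
    by (intro nn_integral_cong) (simp add: fc nrm_R flip: R_diff)
  moreover have "simple_integral M X (s i) \<in> carrier X" for i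
    unfolding simple_integral_def using s[of i]
    by (intro X.finsum_closed) (auto simp: carrier_simple_def smult_closed Pi_def)
  ultimately show ?thesis
    unfolding has_carrier_integral_def using f s lim x
    by (auto simp: strongly_measurable_R simple_integral_R carrier_simple_R
        intro!: exI[of _ "\<lambda>i t. R (s i t)"] limitin_R)
qed

end

lemma (in isometry) weak_derivative_R:
  assumes "weak_derivative T X u g" "\<And>t. u t \<in> carrier X" "\<And>t. g t \<in> carrier X"
  shows "weak_derivative T Y (\<lambda>t. R (u t)) (\<lambda>t. R (g t))"
  unfolding weak_derivative_def
proof (intro allI impI)
  fix \<phi> assume "test_function T \<phi>"
  with assms(1) obtain y where y: "y \<in> carrier X"
    "has_carrier_integral (interval_measure T) X (\<lambda>t. of_real (deriv \<phi> t) \<odot>\<^bsub>X\<^esub> u t) (\<ominus>\<^bsub>X\<^esub> y)"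
    "has_carrier_integral (interval_measure T) X (\<lambda>t. of_real (\<phi> t) \<odot>\<^bsub>X\<^esub> g t) y"
    unfolding weak_derivative_def by blast
  show "\<exists>y\<in>carrier Y.
      has_carrier_integral (interval_measure T) Y (\<lambda>t. of_real (deriv \<phi> t) \<odot>\<^bsub>Y\<^esub> R (u t)) (\<ominus>\<^bsub>Y\<^esub> y) \<and>
      has_carrier_integral (interval_measure T) Y (\<lambda>t. of_real (\<phi> t) \<odot>\<^bsub>Y\<^esub> R (g t)) y"
    using has_carrier_integral_R[OF y(2)] has_carrier_integral_R[OF y(3)] y(1)
    by (intro bexI[of _ "R y"]) (simp_all add: R_smult R_minus R_closed assms)
qed

section \<open>The Hilbert space of square-summable sequences\<close>

definition ell2 :: "(nat \<Rightarrow> complex) hilbert" where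
  "ell2 = \<lparr>carrier = {x. summable (\<lambda>n. (cmod (x n))\<^sup>2)}, monoid.mult = undefined, one = undefined,
     ring.zero = (\<lambda>n. 0), add = (\<lambda>x y n. x n + y n), smult = (\<lambda>c x n. c * x n),
     nrm = (\<lambda>x. sqrt (\<Sum>n. (cmod (x n))\<^sup>2)), ip = (\<lambda>x y. \<Sum>n. x n * cnj (y n))\<rparr>"

lemma mem_ell2: "x \<in> carrier ell2 \<longleftrightarrow> summable (\<lambda>n. (cmod (x n))\<^sup>2)"
  and nrm_ell2: "nrm ell2 x = sqrt (\<Sum>n. (cmod (x n))\<^sup>2)"
  and ip_ell2: "ip ell2 x y = (\<Sum>n. x n * cnj (y n))"
  and ell2_ops [simp]: "add ell2 x y = (\<lambda>n. x n + y n)" "smult ell2 c x = (\<lambda>n. c * x n)"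
    "ring.zero ell2 = (\<lambda>n. 0)"
  by (simp_all add: ell2_def)

text \<open>
  Norm bounds are obtained from the finite sections, for which \<open>L2_set\<close> provides the triangle
  inequality and the Cauchy-Schwarz inequality.
\<close>

lemma ell2_boundedI:
  assumes "\<And>k. L2_set (\<lambda>n. cmod (x n)) {..<k} \<le> B"
  shows "x \<in> carrier ell2" and "nrm ell2 x \<le> B"
proof -
  have B: "0 \<le> B" using assms[of 0] by simp
  have le: "(\<Sum>n<k. (cmod (x n))\<^sup>2) \<le> B\<^sup>2" for k
    using assms[of k] B unfolding L2_set_def by (metis sqrt_le_D)
  show x: "x \<in> carrier ell2"
    unfolding mem_ell2 by (rule summableI_nonneg_bounded[where x = "B\<^sup>2"]) (use le in auto)
  have "(\<Sum>n. (cmod (x n))\<^sup>2) \<le> B\<^sup>2"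
    using x le unfolding mem_ell2 by (rule suminf_le_const)
  then show "nrm ell2 x \<le> B"
    unfolding nrm_ell2 using B real_le_lsqrt by (simp add: real_le_lsqrt sum_nonneg suminf_nonneg x[unfolded mem_ell2])
qed

lemma L2_set_le_nrm:
  assumes "x \<in> carrier ell2" "finite A"
  shows "L2_set (\<lambda>n. cmod (x n)) A \<le> nrm ell2 x"
  unfolding L2_set_def nrm_ell2
  by (rule real_sqrt_le_mono, rule sum_le_suminf) (use assms in \<open>auto simp: mem_ell2\<close>)

lemma cmod_le_nrm:
  assumes "x \<in> carrier ell2" shows "cmod (x n) \<le> nrm ell2 x"
  using L2_set_le_nrm[OF assms, of "{n}"] by simp

lemma nrm_ell2_nonneg: "x \<in> carrier ell2 \<Longrightarrow> 0 \<le> nrm ell2 x"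
  by (auto simp: nrm_ell2 mem_ell2 suminf_nonneg)

lemma ell2_add:
  assumes "x \<in> carrier ell2" "y \<in> carrier ell2"
  shows "(\<lambda>n. x n + y n) \<in> carrier ell2" "nrm ell2 (\<lambda>n. x n + y n) \<le> nrm ell2 x + nrm ell2 y"
proof -
  have "L2_set (\<lambda>n. cmod (x n + y n)) {..<k} \<le> nrm ell2 x + nrm ell2 y" for k
  proof -
    have "L2_set (\<lambda>n. cmod (x n + y n)) {..<k} \<le> L2_set (\<lambda>n. cmod (x n) + cmod (y n)) {..<k}"
      by (intro L2_set_mono norm_triangle_ineq) auto
    also have "\<dots> \<le> L2_set (\<lambda>n. cmod (x n)) {..<k} + L2_set (\<lambda>n. cmod (y n)) {..<k}"
      by (rule L2_set_triangle_ineq)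
    also have "\<dots> \<le> nrm ell2 x + nrm ell2 y"
      by (intro add_mono L2_set_le_nrm assms) auto
    finally show ?thesis .
  qed
  then show "(\<lambda>n. x n + y n) \<in> carrier ell2" "nrm ell2 (\<lambda>n. x n + y n) \<le> nrm ell2 x + nrm ell2 y"
    by (auto intro: ell2_boundedI)
qed

lemma ell2_smult:
  assumes "x \<in> carrier ell2"
  shows "(\<lambda>n. c * x n) \<in> carrier ell2" "nrm ell2 (\<lambda>n. c * x n) = cmod c * nrm ell2 x"
proof -
  have eq: "(cmod (c * x n))\<^sup>2 = (cmod c)\<^sup>2 * (cmod (x n))\<^sup>2" for n
    by (simp add: norm_mult power_mult_distrib)
  show "(\<lambda>n. c * x n) \<in> carrier ell2"
    using assms unfolding mem_ell2 eq by (rule summable_mult)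
  show "nrm ell2 (\<lambda>n. c * x n) = cmod c * nrm ell2 x"
    using assms unfolding mem_ell2 nrm_ell2 eq by (simp add: suminf_mult real_sqrt_mult)
qed

lemma ell2_uminus:
  assumes "x \<in> carrier ell2"
  shows "(\<lambda>n. - x n) \<in> carrier ell2" "nrm ell2 (\<lambda>n. - x n) = nrm ell2 x"
  using assms by (simp_all add: mem_ell2 nrm_ell2)

lemma ell2_diff:
  assumes "x \<in> carrier ell2" "y \<in> carrier ell2"
  shows "(\<lambda>n. x n - y n) \<in> carrier ell2"
  using ell2_add(1)[OF assms(1) ell2_uminus(1)[OF assms(2)]] by simp

lemma ell2_mono:
  assumes "y \<in> carrier ell2" "\<And>n. cmod (x n) \<le> cmod (y n)"
  shows "x \<in> carrier ell2" "nrm ell2 x \<le> nrm ell2 y"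
proof -
  have "L2_set (\<lambda>n. cmod (x n)) {..<k} \<le> nrm ell2 y" for k
    by (rule order_trans[OF L2_set_mono L2_set_le_nrm]) (use assms in auto)
  then show "x \<in> carrier ell2" "nrm ell2 x \<le> nrm ell2 y"
    by (auto intro: ell2_boundedI)
qed

lemma ell2_ip:
  assumes "x \<in> carrier ell2" "y \<in> carrier ell2"
  shows "summable (\<lambda>n. x n * cnj (y n))" "cmod (ip ell2 x y) \<le> nrm ell2 x * nrm ell2 y"
proof -
  have le: "(\<Sum>n<k. norm (x n * cnj (y n))) \<le> nrm ell2 x * nrm ell2 y" for k
  proof -
    have "(\<Sum>n<k. norm (x n * cnj (y n)))
      \<le> L2_set (\<lambda>n. cmod (x n)) {..<k} * L2_set (\<lambda>n. cmod (y n)) {..<k}"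
      using L2_set_mult_ineq[of "\<lambda>n. cmod (x n)" "\<lambda>n. cmod (y n)" "{..<k}"] by (simp add: norm_mult)
    also have "\<dots> \<le> nrm ell2 x * nrm ell2 y"
      by (intro mult_mono L2_set_le_nrm assms) (use assms in \<open>auto simp: L2_set_nonneg nrm_ell2_nonneg\<close>)
    finally show ?thesis .
  qed
  have abs: "summable (\<lambda>n. norm (x n * cnj (y n)))"
    by (rule summableI_nonneg_bounded[OF _ le]) auto
  then show "summable (\<lambda>n. x n * cnj (y n))" by (rule summable_norm_cancel)
  have "cmod (ip ell2 x y) \<le> (\<Sum>n. norm (x n * cnj (y n)))"
    unfolding ip_ell2 by (rule summable_norm[OF abs])
  also have "\<dots> \<le> nrm ell2 x * nrm ell2 y"
    by (rule suminf_le_const[OF abs le])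
  finally show "cmod (ip ell2 x y) \<le> nrm ell2 x * nrm ell2 y" .
qed

lemma ip_self:
  assumes "x \<in> carrier ell2"
  shows "ip ell2 x x = of_real ((nrm ell2 x)\<^sup>2)"
proof -
  have s: "summable (\<lambda>n. (cmod (x n))\<^sup>2)" using assms by (simp add: mem_ell2)
  have "ip ell2 x x = (\<Sum>n. of_real ((cmod (x n))\<^sup>2))"
    by (simp only: ip_ell2 complex_norm_square)
  also have "\<dots> = of_real (\<Sum>n. (cmod (x n))\<^sup>2)"
    using suminf_of_real[OF s, where ?'a = complex] by simp
  finally show ?thesis using s by (simp add: nrm_ell2 suminf_nonneg)
qed

lemma nrm_ell2_eq_0:
  assumes "x \<in> carrier ell2" shows "nrm ell2 x = 0 \<longleftrightarrow> x = (\<lambda>n. 0)"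
proof
  assume "nrm ell2 x = 0"
  then show "x = (\<lambda>n. 0)" using cmod_le_nrm[OF assms] by auto
qed (simp add: nrm_ell2)

lemma abelian_group_ell2: "abelian_group ell2"
proof (rule abelian_groupI)
  fix x assume "x \<in> carrier ell2"
  then show "\<exists>y\<in>carrier ell2. y \<oplus>\<^bsub>ell2\<^esub> x = \<zero>\<^bsub>ell2\<^esub>"
    by (intro bexI[of _ "\<lambda>n. - x n"]) (auto simp: ell2_uminus)
qed (auto simp: ell2_add add_ac, auto simp: mem_ell2)

lemma ell2_a_inv: "x \<in> carrier ell2 \<Longrightarrow> \<ominus>\<^bsub>ell2\<^esub> x = (\<lambda>n. - x n)"
  by (rule abelian_group.minus_equality[OF abelian_group_ell2]) (auto simp: ell2_uminus)

lemma ell2_a_minus: "y \<in> carrier ell2 \<Longrightarrow> x \<ominus>\<^bsub>ell2\<^esub> y = (\<lambda>n. x n - y n)"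
  by (simp add: a_minus_def ell2_a_inv)

interpretation ell2: normed_group ell2
  by (intro normed_group.intro abelian_group_ell2 normed_group_axioms.intro)
     (auto simp: nrm_ell2_eq_0 ell2_a_inv ell2_uminus ell2_add)

text \<open>
  Dominated convergence for sequences (Tannery's theorem). It is stated for arbitrary filters because
  it serves for sequences as well as for continuity in the time variable.
\<close>

lemma nrm_tendsto_0:
  fixes x :: "'i \<Rightarrow> nat \<Rightarrow> complex"
  assumes lim: "\<And>n. ((\<lambda>i. x i n) \<longlongrightarrow> 0) F"
    and le: "eventually (\<lambda>i. \<forall>n. cmod (x i n) \<le> c n) F" and c: "summable (\<lambda>n. (c n)\<^sup>2)"
  shows "((\<lambda>i. nrm ell2 (x i)) \<longlongrightarrow> 0) F"
proof (cases "F = bot")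
  case False
  have "((\<lambda>i. \<Sum>n. (cmod (x i n))\<^sup>2) \<longlongrightarrow> (\<Sum>n. 0)) F"
  proof (rule tannerys_theorem[THEN conjunct2, THEN conjunct2, OF _ _ c False])
    show "((\<lambda>i. (cmod (x i n))\<^sup>2) \<longlongrightarrow> 0) F" for n
      using tendsto_power[OF tendsto_norm_zero[OF lim[of n]], of 2] by simp
    show "\<forall>\<^sub>F (n, i) in sequentially \<times>\<^sub>F F. norm ((cmod (x i n))\<^sup>2) \<le> (c n)\<^sup>2"
      unfolding eventually_prod_filter case_prod_conv
      by (intro exI[of _ "\<lambda>_. True"] exI[of _ "\<lambda>i. \<forall>n. cmod (x i n) \<le> c n"] conjI le)
         (auto intro: power_mono)
  qed
  then show ?thesis
    unfolding nrm_ell2 using tendsto_real_sqrt by fastforce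
qed auto

lemma mcomplete_ell2: "ell2.metric.mcomplete"
  unfolding ell2.metric.mcomplete_def
proof (intro allI impI)
  fix \<sigma> assume "ell2.metric.MCauchy \<sigma>"
  then have \<sigma>: "\<sigma> i \<in> carrier ell2"
    and Cauchy: "\<And>e. e > 0 \<Longrightarrow> \<exists>N. \<forall>i j. N \<le> i \<longrightarrow> N \<le> j \<longrightarrow> nrm ell2 (\<lambda>n. \<sigma> i n - \<sigma> j n) < e" for i
    unfolding ell2.metric.MCauchy_def
    by (auto simp: ndist_def ell2_a_minus image_subset_iff)
  have "Cauchy (\<lambda>i. \<sigma> i n)" for n
  proof (rule CauchyI)
    fix e :: real assume "0 < e"
    from Cauchy[OF this] obtain N where
      N: "nrm ell2 (\<lambda>n. \<sigma> i n - \<sigma> j n) < e" if "N \<le> i" "N \<le> j" for i j by blast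
    show "\<exists>N. \<forall>i\<ge>N. \<forall>j\<ge>N. norm (\<sigma> i n - \<sigma> j n) < e"
      using N cmod_le_nrm[OF ell2_diff[OF \<sigma> \<sigma>]] by (meson le_less_trans)
  qed
  then obtain l where l: "(\<lambda>i. \<sigma> i n) \<longlonglongrightarrow> l n" for n
    unfolding Cauchy_convergent_iff convergent_def by metis
  have key: "\<exists>N. \<forall>i\<ge>N. (\<lambda>n. \<sigma> i n - l n) \<in> carrier ell2 \<and> nrm ell2 (\<lambda>n. \<sigma> i n - l n) \<le> e"
    if "0 < e" for e
  proof -
    from Cauchy[OF that] obtain N where
      N: "nrm ell2 (\<lambda>n. \<sigma> i n - \<sigma> j n) < e" if "N \<le> i" "N \<le> j" for i j by blast
    have "L2_set (\<lambda>n. cmod (\<sigma> i n - l n)) {..<k} \<le> e" if i: "N \<le> i" for i k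
    proof (rule LIMSEQ_le_const2)
      show "(\<lambda>j. L2_set (\<lambda>n. cmod (\<sigma> i n - \<sigma> j n)) {..<k}) \<longlonglongrightarrow> L2_set (\<lambda>n. cmod (\<sigma> i n - l n)) {..<k}"
        unfolding L2_set_def by (intro tendsto_intros l)
      show "\<exists>N. \<forall>j\<ge>N. L2_set (\<lambda>n. cmod (\<sigma> i n - \<sigma> j n)) {..<k} \<le> e"
        using N[OF i] L2_set_le_nrm[OF ell2_diff[OF \<sigma> \<sigma>], of "{..<k}"]
        by (meson finite_lessThan less_imp_le order_trans)
    qed
    then show ?thesis by (auto intro!: exI[of _ N] ell2_boundedI)
  qed
  \<comment> \<open>The limit differs from a member of the sequence by a square-summable sequence.\<close>
  from key[of 1] obtain N where "(\<lambda>n. \<sigma> N n - l n) \<in> carrier ell2" by auto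
  from ell2_diff[OF \<sigma>[of N] this] have lc: "l \<in> carrier ell2" by simp
  have "(\<lambda>i. nrm ell2 (\<lambda>n. \<sigma> i n - l n)) \<longlonglongrightarrow> 0"
  proof (rule LIMSEQ_I)
    fix e :: real assume "0 < e"
    then have "e / 2 > 0" by simp
    from key[OF this] \<open>0 < e\<close> show "\<exists>N. \<forall>i\<ge>N. norm (nrm ell2 (\<lambda>n. \<sigma> i n - l n) - 0) < e"
      by (fastforce simp: nrm_ell2_nonneg)
  qed
  then have "limitin (ntop ell2) \<sigma> l sequentially"
    by (simp add: ell2.limitin_iff \<sigma> lc ell2_a_minus)
  then show "\<exists>x. limitin (ntop ell2) \<sigma> x sequentially" by blast
qed

lemma ip_ell2_add:
  assumes "x \<in> carrier ell2" "y \<in> carrier ell2" "z \<in> carrier ell2"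
  shows "ip ell2 (\<lambda>n. x n + y n) z = ip ell2 x z + ip ell2 y z"
    "ip ell2 z (\<lambda>n. x n + y n) = ip ell2 z x + ip ell2 z y"
  using assms by (simp_all add: ip_ell2 distrib_left distrib_right suminf_add ell2_ip)

lemma ip_ell2_smult:
  assumes "x \<in> carrier ell2" "y \<in> carrier ell2"
  shows "ip ell2 (\<lambda>n. c * x n) y = c * ip ell2 x y"
    "ip ell2 x (\<lambda>n. c * y n) = cnj c * ip ell2 x y"
  using suminf_mult[OF ell2_ip(1)[OF assms], of c] suminf_mult[OF ell2_ip(1)[OF assms], of "cnj c"]
  by (simp_all add: ip_ell2 mult_ac)

lemma hilbert_space_ell2: "hilbert_space UNIV ell2"
proof (rule hilbert_space.intro)
  have grp: "abelian_group (scalar_ring UNIV)"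
    by (rule abelian_groupI) (auto simp: scalar_ring_def intro: exI[of _ "- _"])
  have "cring (scalar_ring UNIV)"
    by (rule cringI[OF grp])
       (auto simp: scalar_ring_def algebra_simps intro!: Group.comm_monoidI)
  then show "module (scalar_ring UNIV) ell2"
    by (rule moduleI[OF _ abelian_group_ell2])
       (auto simp: ell2_smult, auto simp: scalar_ring_def algebra_simps)
next
  fix x y assume "x \<in> carrier ell2" "y \<in> carrier ell2"
  then show "ip ell2 y x = cnj (ip ell2 x y)"
    by (simp add: ip_ell2 bounded_linear.suminf[OF bounded_linear_cnj ell2_ip(1)] mult.commute)
next
  fix x assume x: "x \<in> carrier ell2"
  then show "nrm ell2 x = sqrt (Re (ip ell2 x x))"
    by (simp add: ip_self nrm_ell2_nonneg)
  assume "x \<noteq> \<zero>\<^bsub>ell2\<^esub>"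
  then show "0 < Re (ip ell2 x x)"
    using x by (simp add: ip_self nrm_ell2_eq_0)
qed (auto simp: ip_ell2_add ip_ell2_smult mcomplete_ell2)

section \<open>The antidual and the Riesz isometry\<close>

abbreviation ell2' :: "((nat \<Rightarrow> complex) \<Rightarrow> complex) normed" where
  "ell2' \<equiv> antidual UNIV ell2"

lemma antidual_ops [simp]:
  "add (antidual K V) \<phi> \<psi> = (\<lambda>v\<in>carrier V. \<phi> v + \<psi> v)"
  "smult (antidual K V) c \<phi> = (\<lambda>v\<in>carrier V. c * \<phi> v)"
  "ring.zero (antidual K V) = (\<lambda>v\<in>carrier V. 0)"
  by (simp_all add: antidual_def)

lemma mem_ell2': "\<phi> \<in> carrier ell2' \<longleftrightarrow> \<phi> \<in> extensional (carrier ell2) \<and> antilinear_on UNIV ell2 \<phi> \<and>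
    (\<exists>C. \<forall>v\<in>carrier ell2. cmod (\<phi> v) \<le> C * nrm ell2 v)"
  and nrm_ell2': "nrm ell2' \<phi> = (SUP v\<in>{v \<in> carrier ell2. nrm ell2 v \<le> 1}. cmod (\<phi> v))"
  by (auto simp: antidual_def PiE_def)

text \<open>
  The supremum that defines the dual norm is a real number only because the values on the unit ball are
  bounded; the general case follows by scaling.
\<close>

lemma ell2'_apply_le:
  assumes "\<phi> \<in> carrier ell2'" "v \<in> carrier ell2"
  shows "cmod (\<phi> v) \<le> nrm ell2' \<phi> * nrm ell2 v"
proof -
  obtain C where C: "\<And>v. v \<in> carrier ell2 \<Longrightarrow> cmod (\<phi> v) \<le> C * nrm ell2 v"
    using assms(1) by (auto simp: mem_ell2')
  have bdd: "bdd_above ((\<lambda>v. cmod (\<phi> v)) ` {v \<in> carrier ell2. nrm ell2 v \<le> 1})"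
  proof (rule bdd_aboveI2)
    fix v assume v: "v \<in> {v \<in> carrier ell2. nrm ell2 v \<le> 1}"
    then have "cmod (\<phi> v) \<le> C * nrm ell2 v" using C by auto
    also have "\<dots> \<le> \<bar>C\<bar> * 1"
      using v by (intro mult_mono) (auto simp: nrm_ell2_nonneg)
    finally show "cmod (\<phi> v) \<le> \<bar>C\<bar> * 1" .
  qed
  have scale: "\<phi> (\<lambda>n. c * v n) = cnj c * \<phi> v" for c
    using assms by (auto simp: mem_ell2' antilinear_on_def)
  show ?thesis
  proof (cases "nrm ell2 v = 0")
    case True
    then show ?thesis using C[OF assms(2)] by simp
  next
    case False
    then have pos: "0 < nrm ell2 v" using nrm_ell2_nonneg[OF assms(2)] by simp
    define c where "c = complex_of_real (inverse (nrm ell2 v))"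
    have c: "cmod c = inverse (nrm ell2 v)" using pos by (simp add: c_def norm_inverse)
    have "(\<lambda>n. c * v n) \<in> carrier ell2" "nrm ell2 (\<lambda>n. c * v n) = 1"
      using ell2_smult[OF assms(2), of c] pos by (auto simp: c)
    then have "cmod (\<phi> (\<lambda>n. c * v n)) \<le> nrm ell2' \<phi>"
      unfolding nrm_ell2' by (intro cSUP_upper bdd) auto
    then show ?thesis
      using pos by (simp add: scale norm_mult c field_simps)
  qed
qed

lemma nrm_ell2'_leI:
  assumes "\<And>v. v \<in> carrier ell2 \<Longrightarrow> cmod (\<phi> v) \<le> C * nrm ell2 v" "0 \<le> C"
  shows "nrm ell2' \<phi> \<le> C"
  unfolding nrm_ell2'
proof (rule cSUP_least)
  have "(\<lambda>n. 0) \<in> {v \<in> carrier ell2. nrm ell2 v \<le> 1}"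
    by (simp add: mem_ell2 nrm_ell2)
  then show "{v \<in> carrier ell2. nrm ell2 v \<le> 1} \<noteq> {}" by blast
  fix v assume v: "v \<in> {v \<in> carrier ell2. nrm ell2 v \<le> 1}"
  then have "cmod (\<phi> v) \<le> C * nrm ell2 v" using assms by auto
  also have "\<dots> \<le> C" using v assms(2) by (simp add: mult_left_le)
  finally show "cmod (\<phi> v) \<le> C" .
qed

lemma nrm_ell2'_nonneg: "\<phi> \<in> carrier ell2' \<Longrightarrow> 0 \<le> nrm ell2' \<phi>"
proof -
  assume \<phi>: "\<phi> \<in> carrier ell2'"
  define v :: "nat \<Rightarrow> complex" where "v n = (if n = 0 then 1 else 0)" for n
  have "(\<lambda>n. (cmod (v n))\<^sup>2) sums 1"
    using sums_single[of 0 "\<lambda>n. 1::real"] by (rule sums_cong[THEN iffD1, rotated]) (simp add: v_def)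
  then have v: "v \<in> carrier ell2" "nrm ell2 v = 1"
    by (auto simp: mem_ell2 nrm_ell2 sums_iff)
  then show ?thesis using ell2'_apply_le[OF \<phi> v(1)] norm_ge_zero[of "\<phi> v"]
    by (metis mult_1_right order_trans v(2))
qed

lemma ell2'_scale:
  assumes "\<phi> \<in> carrier ell2'"
  shows "(\<lambda>v\<in>carrier ell2. c * \<phi> v) \<in> carrier ell2'"
proof -
  have "antilinear_on UNIV ell2 (\<lambda>v\<in>carrier ell2. c * \<phi> v)"
    using assms by (auto simp: mem_ell2' antilinear_on_def ell2_add ell2_smult algebra_simps)
  moreover have "\<forall>v\<in>carrier ell2. cmod ((\<lambda>v\<in>carrier ell2. c * \<phi> v) v) \<le> (cmod c * nrm ell2' \<phi>) * nrm ell2 v"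
    using ell2'_apply_le[OF assms] by (auto simp: norm_mult mult.assoc intro!: mult_left_mono)
  ultimately show ?thesis unfolding mem_ell2' by blast
qed

lemma ell2'_add:
  assumes "\<phi> \<in> carrier ell2'" "\<psi> \<in> carrier ell2'"
  shows "(\<lambda>v\<in>carrier ell2. \<phi> v + \<psi> v) \<in> carrier ell2'"
    "nrm ell2' (\<lambda>v\<in>carrier ell2. \<phi> v + \<psi> v) \<le> nrm ell2' \<phi> + nrm ell2' \<psi>"
proof -
  have le: "cmod ((\<lambda>v\<in>carrier ell2. \<phi> v + \<psi> v) v) \<le> (nrm ell2' \<phi> + nrm ell2' \<psi>) * nrm ell2 v"
    if v: "v \<in> carrier ell2" for v
    using norm_triangle_ineq[of "\<phi> v" "\<psi> v"] ell2'_apply_le[OF assms(1) v] ell2'_apply_le[OF assms(2) v] v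
    by (simp add: distrib_right)
  have "antilinear_on UNIV ell2 (\<lambda>v\<in>carrier ell2. \<phi> v + \<psi> v)"
    using assms by (auto simp: mem_ell2' antilinear_on_def ell2_add ell2_smult algebra_simps)
  then show "(\<lambda>v\<in>carrier ell2. \<phi> v + \<psi> v) \<in> carrier ell2'"
    unfolding mem_ell2' using le by blast
  show "nrm ell2' (\<lambda>v\<in>carrier ell2. \<phi> v + \<psi> v) \<le> nrm ell2' \<phi> + nrm ell2' \<psi>"
    using le by (rule nrm_ell2'_leI) (auto intro: add_nonneg_nonneg nrm_ell2'_nonneg assms)
qed

lemma zero_ell2': "(\<lambda>v\<in>carrier ell2. 0) \<in> carrier ell2'"
  by (auto simp: mem_ell2' antilinear_on_def ell2_add ell2_smult intro!: exI[of _ 0])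

lemma abelian_group_ell2': "abelian_group ell2'"
proof (rule abelian_groupI)
  fix \<phi> assume \<phi>: "\<phi> \<in> carrier ell2'"
  show "\<exists>\<psi>\<in>carrier ell2'. \<psi> \<oplus>\<^bsub>ell2'\<^esub> \<phi> = \<zero>\<^bsub>ell2'\<^esub>"
    by (rule bexI[of _ "\<lambda>v\<in>carrier ell2. -1 * \<phi> v"]) (use ell2'_scale[OF \<phi>, of "-1"] in \<open>auto simp: fun_eq_iff\<close>)
  show "\<zero>\<^bsub>ell2'\<^esub> \<oplus>\<^bsub>ell2'\<^esub> \<phi> = \<phi>"
    using \<phi> by (auto simp: mem_ell2' extensional_def fun_eq_iff)
qed (auto simp: ell2'_add zero_ell2' fun_eq_iff add_ac)

lemma ell2'_a_inv: "\<phi> \<in> carrier ell2' \<Longrightarrow> \<ominus>\<^bsub>ell2'\<^esub> \<phi> = (\<lambda>v\<in>carrier ell2. - \<phi> v)"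
  by (rule abelian_group.minus_equality[OF abelian_group_ell2'])
     (use ell2'_scale[of \<phi> "-1"] in \<open>auto simp: fun_eq_iff\<close>)

lemma normed_group_ell2': "normed_group ell2'"
proof (intro normed_group.intro abelian_group_ell2' normed_group_axioms.intro)
  fix \<phi> assume \<phi>: "\<phi> \<in> carrier ell2'"
  show "nrm ell2' \<phi> = 0 \<longleftrightarrow> \<phi> = \<zero>\<^bsub>ell2'\<^esub>"
  proof
    assume "nrm ell2' \<phi> = 0"
    then have "\<phi> v = 0" if "v \<in> carrier ell2" for v
      using ell2'_apply_le[OF \<phi> that] by simp
    then show "\<phi> = \<zero>\<^bsub>ell2'\<^esub>"
      using \<phi> by (auto simp: mem_ell2' extensional_def fun_eq_iff)
  next
    assume "\<phi> = \<zero>\<^bsub>ell2'\<^esub>"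
    then have "nrm ell2' \<phi> \<le> 0" by (intro nrm_ell2'_leI) auto
    then show "nrm ell2' \<phi> = 0" using nrm_ell2'_nonneg[OF \<phi>] by simp
  qed
  show "nrm ell2' (\<ominus>\<^bsub>ell2'\<^esub> \<phi>) = nrm ell2' \<phi>"
    unfolding ell2'_a_inv[OF \<phi>] nrm_ell2' by (rule SUP_cong) auto
qed (auto simp: ell2'_add)

interpretation ell2': normed_group ell2'
  by (rule normed_group_ell2')

definition riesz :: "(nat \<Rightarrow> complex) \<Rightarrow> (nat \<Rightarrow> complex) \<Rightarrow> complex" where
  "riesz z = (\<lambda>v\<in>carrier ell2. ip ell2 z v)"

lemma riesz_closed: "z \<in> carrier ell2 \<Longrightarrow> riesz z \<in> carrier ell2'"
  unfolding mem_ell2'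
  by (auto simp: riesz_def antilinear_on_def ell2_add ell2_smult ip_ell2_add ip_ell2_smult
      intro!: exI[of _ "nrm ell2 z"] ell2_ip)

lemma riesz_add: "\<lbrakk>y \<in> carrier ell2; z \<in> carrier ell2\<rbrakk>
    \<Longrightarrow> riesz (\<lambda>n. y n + z n) = riesz y \<oplus>\<^bsub>ell2'\<^esub> riesz z"
  by (auto simp: riesz_def ip_ell2_add fun_eq_iff)

lemma riesz_smult: "z \<in> carrier ell2 \<Longrightarrow> riesz (\<lambda>n. c * z n) = c \<odot>\<^bsub>ell2'\<^esub> riesz z"
  by (auto simp: riesz_def ip_ell2_smult fun_eq_iff)

text \<open>
  Evaluation at \<open>z\<close> itself shows that the Cauchy-Schwarz bound is attained.
\<close>

lemma nrm_riesz:
  assumes z: "z \<in> carrier ell2"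
  shows "nrm ell2' (riesz z) = nrm ell2 z"
proof (rule antisym)
  show "nrm ell2' (riesz z) \<le> nrm ell2 z"
    by (rule nrm_ell2'_leI) (auto simp: riesz_def nrm_ell2_nonneg ell2_ip z)
  have "(nrm ell2 z)\<^sup>2 \<le> nrm ell2' (riesz z) * nrm ell2 z"
    using ell2'_apply_le[OF riesz_closed[OF z] z] z by (simp add: riesz_def ip_self norm_power nrm_ell2_nonneg)
  then show "nrm ell2 z \<le> nrm ell2' (riesz z)"
    using nrm_ell2_nonneg[OF z] nrm_ell2'_nonneg[OF riesz_closed[OF z]]
    by (cases "nrm ell2 z = 0") (auto simp: power2_eq_square)
qed

interpretation riesz: isometry ell2 ell2' riesz
  by (intro isometry.intro isometry_axioms.intro ell2.normed_group_axioms ell2'.normed_group_axioms)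
     (auto simp: riesz_closed nrm_riesz ell2_smult riesz_smult[simplified] riesz_add[simplified])

section \<open>Integration of square-summable curves\<close>

lemma finite_measure_interval: "finite_measure (interval_measure T)"
  by (intro finite_measure_lebesgue_on) auto

lemma finsum_ell2:
  assumes "finite A" "g \<in> A \<rightarrow> carrier ell2"
  shows "finsum ell2 g A n = (\<Sum>a\<in>A. g a n)"
  using assms by (induction rule: finite_induct) (auto simp: ell2.finsum_insert Pi_def)

text \<open>
  Carrier integrals are compared with Lebesgue integrals through the coordinates, beginning with
  simple functions.
\<close>

lemma simple_coordinate:
  assumes "finite_measure M" and s: "carrier_simple M ell2 s"
  shows "integrable M (\<lambda>t. s t n)" and "simple_integral M ell2 s n = (\<integral>t. s t n \<partial>M)"
    and "simple_integral M ell2 s \<in> carrier ell2"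
proof -
  interpret finite_measure M by fact
  let ?A = "\<lambda>x. s -` {x} \<inter> space M"
  have fin: "finite (s ` space M)" and A: "?A x \<in> sets M" for x
    using s simple_functionD by (auto simp: carrier_simple_def)
  have eq: "s t n = (\<Sum>x\<in>s ` space M. of_real (indicator (?A x) t) * x n)" if "t \<in> space M" for t
  proof -
    have "(\<Sum>x\<in>s ` space M. of_real (indicator (?A x) t) * x n) = (\<Sum>x\<in>{s t}. of_real (indicator (?A x) t) * x n)"
      by (rule sum.mono_neutral_right) (use fin that in auto)
    then show ?thesis using that by simp
  qed
  have int: "integrable M (\<lambda>t. of_real (indicator (?A x) t) * x n)" for x
  proof (rule integrable_const_bound[OF AE_I2])
    show "(\<lambda>t. of_real (indicator (?A x) t) * x n) \<in> borel_measurable M"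
      using A[of x] by (intro borel_measurable_times borel_measurable_of_real borel_measurable_indicator) auto
    show "norm (of_real (indicator (?A x) t) * x n) \<le> cmod (x n)" for t
      by (simp add: indicator_def)
  qed
  show "integrable M (\<lambda>t. s t n)"
    by (subst Bochner_Integration.integrable_cong[OF refl eq]) (auto intro: int)
  have sc: "(\<lambda>x. complex_of_real (measure M (?A x)) \<odot>\<^bsub>ell2\<^esub> x) \<in> s ` space M \<rightarrow> carrier ell2"
    using s by (auto simp: carrier_simple_def Pi_def ell2_smult)
  have "simple_integral M ell2 s n = (\<Sum>x\<in>s ` space M. complex_of_real (measure M (?A x)) * x n)"
    using finsum_ell2[OF fin sc, of n] by (simp add: simple_integral_def)
  also have "\<dots> = (\<Sum>x\<in>s ` space M. \<integral>t. of_real (indicator (?A x) t) * x n \<partial>M)"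
    using A by (intro sum.cong refl) (simp add: Int_absorb2 sets.sets_into_space)
  also have "\<dots> = (\<integral>t. (\<Sum>x\<in>s ` space M. of_real (indicator (?A x) t) * x n) \<partial>M)"
    by (rule Bochner_Integration.integral_sum[symmetric]) (rule int)
  also have "\<dots> = (\<integral>t. s t n \<partial>M)"
    by (rule Bochner_Integration.integral_cong[OF refl eq[symmetric]])
  finally show "simple_integral M ell2 s n = (\<integral>t. s t n \<partial>M)" .
  show "simple_integral M ell2 s \<in> carrier ell2"
    unfolding simple_integral_def by (rule ell2.finsum_closed[OF sc])
qed

lemma coordinate_tendsto:
  assumes "limitin (ntop ell2) f l F" "\<And>i. f i \<in> carrier ell2"
  shows "((\<lambda>i. f i n) \<longlongrightarrow> l n) F"
proof -
  have l: "l \<in> carrier ell2" using assms(1) ell2.metric.limitin_mspace by blast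
  have "((\<lambda>i. nrm ell2 (\<lambda>n. f i n - l n)) \<longlongrightarrow> 0) F"
    using assms by (simp add: ell2.limitin_iff l ell2_a_minus)
  then have "((\<lambda>i. f i n - l n) \<longlongrightarrow> 0) F"
    by (rule Lim_null_comparison[rotated])
       (auto intro!: always_eventually cmod_le_nrm[OF ell2_diff] assms l)
  then show ?thesis by (simp add: LIM_zero_iff)
qed

text \<open>
  The approximating simple functions converge only almost everywhere, so the completeness of Lebesgue
  measure enters.
\<close>

lemma strongly_measurable_coordinate:
  assumes "strongly_measurable (interval_measure T) ell2 f"
  shows "(\<lambda>t. f t n) \<in> borel_measurable (interval_measure T)"
proof -
  from assms obtain s where s: "\<And>i. carrier_simple (interval_measure T) ell2 (s i)"
    and lim: "AE t in interval_measure T. limitin (ntop ell2) (\<lambda>i. s i t) (f t) sequentially"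
    by (auto simp: strongly_measurable_def)
  define g where "g t = lim (\<lambda>i. s i t n)" for t
  have "(\<lambda>t. s i t n) \<in> borel_measurable (interval_measure T)" for i
    using simple_coordinate(1)[OF finite_measure_interval s] by (rule borel_measurable_integrable)
  then have "g \<in> borel_measurable (interval_measure T)"
    unfolding g_def by (rule borel_measurable_lim_metric)
  then have "(\<lambda>t. if t \<in> {0..T} then g t else 0) \<in> borel_measurable lebesgue"
    by (rule borel_measurable_if_I) auto
  moreover have "AE t in lebesgue. (if t \<in> {0..T} then g t else 0) = (if t \<in> {0..T} then f t n else 0)"
  proof -
    have "AE t in interval_measure T. g t = f t n"
      using lim AE_space
    proof eventually_elim
      case (elim t)
      then have "(\<lambda>i. s i t n) \<longlonglongrightarrow> f t n"
        using s by (intro coordinate_tendsto) (auto simp: carrier_simple_def Pi_def)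
      then show ?case unfolding g_def by (rule limI)
    qed
    then have "AE t in lebesgue. t \<in> {0..T} \<longrightarrow> g t = f t n"
      by (subst (asm) AE_restrict_space_iff) auto
    then show ?thesis by eventually_elim auto
  qed
  ultimately have "(\<lambda>t. if t \<in> {0..T} then f t n else 0) \<in> borel_measurable lebesgue"
    by (rule borel_measurable_AE)
  then show ?thesis by (rule borel_measurable_if_D)
qed

lemma has_carrier_integral_coordinate:
  assumes "has_carrier_integral M ell2 f x" "finite_measure M" and int: "integrable M (\<lambda>t. f t n)"
  shows "x n = (\<integral>t. f t n \<partial>M)"
proof -
  from assms obtain s where f: "strongly_measurable M ell2 f" and s: "\<And>i. carrier_simple M ell2 (s i)"
    and lim: "(\<lambda>i. \<integral>\<^sup>+t. ennreal (nrm ell2 (f t \<ominus>\<^bsub>ell2\<^esub> s i t)) \<partial>M) \<longlonglongrightarrow> 0"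
    and x: "limitin (ntop ell2) (\<lambda>i. simple_integral M ell2 (s i)) x sequentially"
    by (auto simp: has_carrier_integral_def)
  note s' = simple_coordinate[OF assms(2) s]
  have le: "ennreal (cmod ((\<integral>t. f t n \<partial>M) - simple_integral M ell2 (s i) n))
      \<le> (\<integral>\<^sup>+t. ennreal (nrm ell2 (f t \<ominus>\<^bsub>ell2\<^esub> s i t)) \<partial>M)" for i
  proof -
    have "(\<integral>t. f t n \<partial>M) - simple_integral M ell2 (s i) n = (\<integral>t. f t n - s i t n \<partial>M)"
      by (simp add: s' int)
    then have "ennreal (cmod ((\<integral>t. f t n \<partial>M) - simple_integral M ell2 (s i) n))
        \<le> (\<integral>\<^sup>+t. ennreal (cmod (f t n - s i t n)) \<partial>M)"
      using integral_norm_bound_ennreal[of M "\<lambda>t. f t n - s i t n"] int s' by simp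
    also have "\<dots> \<le> (\<integral>\<^sup>+t. ennreal (nrm ell2 (f t \<ominus>\<^bsub>ell2\<^esub> s i t)) \<partial>M)"
    proof (intro nn_integral_mono ennreal_leI)
      fix t assume "t \<in> space M"
      then have "f t \<in> carrier ell2" "s i t \<in> carrier ell2"
        using f s by (auto simp: strongly_measurable_def carrier_simple_def)
      then show "cmod (f t n - s i t n) \<le> nrm ell2 (f t \<ominus>\<^bsub>ell2\<^esub> s i t)"
        using cmod_le_nrm[OF ell2_diff, of "f t" "s i t" n] by (simp add: ell2_a_minus)
    qed
    finally show ?thesis .
  qed
  have "(\<lambda>i. ennreal (cmod ((\<integral>t. f t n \<partial>M) - simple_integral M ell2 (s i) n))) \<longlonglongrightarrow> 0"
    by (rule tendsto_sandwich[OF _ _ tendsto_const lim]) (use le in auto)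
  then have "(\<lambda>i. cmod ((\<integral>t. f t n \<partial>M) - simple_integral M ell2 (s i) n)) \<longlonglongrightarrow> 0"
    by (simp add: ennreal_tendsto_0_iff)
  then have "(\<lambda>i. (\<integral>t. f t n \<partial>M) - simple_integral M ell2 (s i) n) \<longlonglongrightarrow> 0"
    by (rule tendsto_norm_zero_cancel)
  moreover have "(\<lambda>i. (\<integral>t. f t n \<partial>M) - simple_integral M ell2 (s i) n) \<longlonglongrightarrow> (\<integral>t. f t n \<partial>M) - x n"
    by (intro tendsto_intros coordinate_tendsto[OF x] s')
  ultimately have "0 = (\<integral>t. f t n \<partial>M) - x n" by (rule LIMSEQ_unique)
  then show ?thesis by simp
qed

text \<open>
  A class of curves that is large enough for the construction and for which everything can be checked
  coordinatewise. Curves that are Lipschitz or differentiable in the norm would not do: the solution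
  oscillates too fast in \<open>H\<close>.
\<close>

definition dominated_curve :: "real \<Rightarrow> (real \<Rightarrow> nat \<Rightarrow> complex) \<Rightarrow> bool" where
  "dominated_curve T f \<longleftrightarrow> (\<forall>n. continuous_on {0..T} (\<lambda>t. f t n)) \<and>
     (\<exists>c. summable (\<lambda>n. (c n)\<^sup>2) \<and> (\<forall>t\<in>{0..T}. \<forall>n. cmod (f t n) \<le> c n))"

lemma dominated_curve_mem:
  assumes "dominated_curve T f" "t \<in> {0..T}" shows "f t \<in> carrier ell2"
proof -
  obtain c where c: "summable (\<lambda>n. (c n)\<^sup>2)" "\<And>n. cmod (f t n) \<le> c n"
    using assms by (auto simp: dominated_curve_def)
  show ?thesis
    unfolding mem_ell2 by (rule summable_comparison_test'[OF c(1), of 0]) (use c(2) in \<open>auto intro: power_mono\<close>)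
qed

lemma dominated_curve_tendsto:
  assumes f: "dominated_curve T f" and t: "t \<in> {0..T}"
    and \<tau>: "eventually (\<lambda>i. \<tau> i \<in> {0..T}) F" "(\<tau> \<longlongrightarrow> t) F"
  shows "((\<lambda>i. nrm ell2 (\<lambda>n. f (\<tau> i) n - f t n)) \<longlongrightarrow> 0) F"
proof -
  obtain c where c: "summable (\<lambda>n. (c n)\<^sup>2)" "\<And>t n. t \<in> {0..T} \<Longrightarrow> cmod (f t n) \<le> c n"
    using f by (auto simp: dominated_curve_def)
  show ?thesis
  proof (rule nrm_tendsto_0)
    show "((\<lambda>i. f (\<tau> i) n - f t n) \<longlongrightarrow> 0) F" for n
      using f t \<tau> continuous_on_tendsto_compose[of "{0..T}" "\<lambda>t. f t n" \<tau> t F]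
      by (auto simp: dominated_curve_def intro: LIM_zero)
    show "\<forall>\<^sub>F i in F. \<forall>n. cmod (f (\<tau> i) n - f t n) \<le> 2 * c n"
      using \<tau>(1)
    proof eventually_elim
      case (elim i)
      show ?case
      proof
        fix n show "cmod (f (\<tau> i) n - f t n) \<le> 2 * c n"
          using norm_triangle_ineq4[of "f (\<tau> i) n" "f t n"] c(2)[OF elim, of n] c(2)[OF t, of n] by simp
      qed
    qed
    show "summable (\<lambda>n. (2 * c n)\<^sup>2)"
      using c(1) by (simp add: power_mult_distrib summable_mult)
  qed
qed

lemma atin_within_euclidean: "atin_within euclidean t S = at t within S"
  by (simp add: atin_within_def at_within_def nhdsin_def nhds_def)

lemma dominated_curve_continuous:
  assumes f: "dominated_curve T f"
  shows "continuous_map (top_of_set {0..T}) (ntop ell2) f"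
  unfolding continuous_map_atin
proof
  fix t assume "t \<in> topspace (top_of_set {0..T})"
  then have t: "t \<in> {0..T}" by simp
  have ev: "\<forall>\<^sub>F x in at t within {0..T}. x \<in> {0..T}"
    by (simp add: eventually_at_filter)
  have "limitin (ntop ell2) f (f t) (at t within {0..T})"
    unfolding ell2.metric.limitin_metric_dist_null
  proof (intro conjI dominated_curve_mem[OF f] t)
    show "\<forall>\<^sub>F x in at t within {0..T}. f x \<in> carrier ell2"
      using ev by eventually_elim (rule dominated_curve_mem[OF f])
    show "((\<lambda>x. ndist ell2 (f x) (f t)) \<longlongrightarrow> 0) (at t within {0..T})"
    proof (rule Lim_transform_eventually)
      show "((\<lambda>x. nrm ell2 (\<lambda>n. f x n - f t n)) \<longlongrightarrow> 0) (at t within {0..T})"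
        by (rule dominated_curve_tendsto[OF f t ev]) (rule tendsto_ident_at)
      show "\<forall>\<^sub>F x in at t within {0..T}. nrm ell2 (\<lambda>n. f x n - f t n) = ndist ell2 (f x) (f t)"
        using ev by eventually_elim (use dominated_curve_mem[OF f] dominated_curve_mem[OF f t] in \<open>simp add: ndist_def ell2_a_minus\<close>)
    qed
  qed
  then show "limitin (ntop ell2) f (f t) (atin (top_of_set {0..T}) t)"
    using t by (simp add: atin_subtopology_within atin_within_euclidean)
qed

lemma borel_measurable_nrm:
  assumes "\<And>n. (\<lambda>t. f t n) \<in> borel_measurable M"
  shows "(\<lambda>t. nrm ell2 (f t)) \<in> borel_measurable M"
proof -
  note assms[measurable]
  show ?thesis unfolding nrm_ell2 by measurable
qed

lemma dominated_curve_measurable: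
  assumes "dominated_curve T f"
  shows "(\<lambda>t. f t n) \<in> borel_measurable (interval_measure T)"
  using assms unfolding dominated_curve_def
  by (intro continuous_imp_measurable_on_sets_lebesgue) auto

text \<open>
  Rounding \<open>t\<close> down to a multiple of \<open>1 / Suc i\<close> stays inside the interval, and it makes the values
  of the step function values of the curve, so the bounds for \<open>f\<close> also hold for the steps.
\<close>

lemma dominated_curve_steps:
  assumes f: "dominated_curve T f"
  obtains s where "\<And>i. carrier_simple (interval_measure T) ell2 (s i)"
    "\<And>t. t \<in> {0..T} \<Longrightarrow> (\<lambda>i. nrm ell2 (\<lambda>n. s i t n - f t n)) \<longlonglongrightarrow> 0"
    "\<And>i t. t \<in> {0..T} \<Longrightarrow> s i t \<in> f ` {0..T}"
proof
  define \<tau> :: "nat \<Rightarrow> real \<Rightarrow> real" where "\<tau> i t = of_int \<lfloor>real (Suc i) * t\<rfloor> / real (Suc i)" for i t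
  have \<tau>: "\<tau> i t \<in> {0..t}" "t - 1 / real (Suc i) \<le> \<tau> i t" if "0 \<le> t" for i t
  proof -
    have "of_int \<lfloor>real (Suc i) * t\<rfloor> \<le> real (Suc i) * t" "real (Suc i) * t \<le> of_int \<lfloor>real (Suc i) * t\<rfloor> + 1"
      by linarith+
    then show "\<tau> i t \<in> {0..t}"
      using that by (auto simp: \<tau>_def field_simps simp del: of_nat_Suc)
    have "t - 1 / real (Suc i) = (real (Suc i) * t - 1) / real (Suc i)"
      by (simp add: field_simps del: of_nat_Suc)
    also have "\<dots> \<le> \<tau> i t"
      unfolding \<tau>_def by (rule divide_right_mono) linarith+
    finally show "t - 1 / real (Suc i) \<le> \<tau> i t" .
  qed
  show range: "f (\<tau> i t) \<in> f ` {0..T}" if "t \<in> {0..T}" for i t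
    using \<tau>(1)[of t i] that by (intro imageI) auto
  show "carrier_simple (interval_measure T) ell2 (\<lambda>t. f (\<tau> i t))" for i
    unfolding carrier_simple_def
  proof
    have "simple_function (interval_measure T) (\<tau> i)"
    proof (rule simple_function_borel_measurable)
      show "\<tau> i \<in> borel_measurable (interval_measure T)"
        unfolding \<tau>_def
        by (rule measurable_compose[OF continuous_imp_measurable_on_sets_lebesgue[OF continuous_on_id]]) auto
      have sub: "\<tau> i ` {0..T} \<subseteq> (\<lambda>k. of_int k / real (Suc i)) ` {0..\<lfloor>real (Suc i) * T\<rfloor>}"
        unfolding \<tau>_def by (auto intro!: imageI floor_mono mult_left_mono simp del: of_nat_Suc)
      show "finite (\<tau> i ` space (interval_measure T))"
        using finite_subset[OF sub] by simp
    qed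
    then show "simple_function (interval_measure T) (\<lambda>t. f (\<tau> i t))"
      by (rule simple_function_compose1)
    show "(\<lambda>t. f (\<tau> i t)) \<in> space (interval_measure T) \<rightarrow> carrier ell2"
    proof
      fix t assume "t \<in> space (interval_measure T)"
      then have "\<tau> i t \<in> {0..T}" using \<tau>(1)[of t i] by auto
      then show "f (\<tau> i t) \<in> carrier ell2" by (rule dominated_curve_mem[OF f])
    qed
  qed
  show "(\<lambda>i. nrm ell2 (\<lambda>n. f (\<tau> i t) n - f t n)) \<longlonglongrightarrow> 0" if t: "t \<in> {0..T}" for t
  proof (rule dominated_curve_tendsto[OF f t])
    show "\<forall>\<^sub>F i in sequentially. \<tau> i t \<in> {0..T}"
      using \<tau>(1)[of t] t by (intro always_eventually) fastforce
    show "(\<lambda>i. \<tau> i t) \<longlonglongrightarrow> t"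
    proof (rule tendsto_sandwich[OF _ _ _ tendsto_const])
      show "(\<lambda>i. t - 1 / real (Suc i)) \<longlonglongrightarrow> t"
        using tendsto_diff[OF tendsto_const[of t] LIMSEQ_inverse_real_of_nat] by (simp add: inverse_eq_divide)
    qed (use \<tau>[of t] t in auto)
  qed
qed

lemma dominated_curve_strongly_measurable:
  assumes f: "dominated_curve T f"
  shows "strongly_measurable (interval_measure T) ell2 f"
proof -
  obtain s where s: "\<And>i. carrier_simple (interval_measure T) ell2 (s i)"
    "\<And>t. t \<in> {0..T} \<Longrightarrow> (\<lambda>i. nrm ell2 (\<lambda>n. s i t n - f t n)) \<longlonglongrightarrow> 0"
    "\<And>i t. t \<in> {0..T} \<Longrightarrow> s i t \<in> f ` {0..T}"
    using dominated_curve_steps[OF f] by blast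
  have "limitin (ntop ell2) (\<lambda>i. s i t) (f t) sequentially" if t: "t \<in> {0..T}" for t
  proof (subst ell2.limitin_iff)
    show "s i t \<in> carrier ell2" for i
      using s(3)[OF t, of i] dominated_curve_mem[OF f] by auto
    show "f t \<in> carrier ell2" by (rule dominated_curve_mem[OF f t])
    then show "(\<lambda>i. nrm ell2 (s i t \<ominus>\<^bsub>ell2\<^esub> f t)) \<longlonglongrightarrow> 0"
      using s(2)[OF t] by (simp add: ell2_a_minus)
  qed
  then show ?thesis
    unfolding strongly_measurable_def using s(1) dominated_curve_mem[OF f]
    by (auto intro!: exI[of _ s] AE_I2)
qed

lemma dominated_curve_bounded:
  assumes "dominated_curve T f"
  obtains B where "\<And>t. t \<in> {0..T} \<Longrightarrow> nrm ell2 (f t) \<le> B"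
proof -
  from assms obtain c where c: "summable (\<lambda>n. (c n)\<^sup>2)" "\<And>t n. t \<in> {0..T} \<Longrightarrow> cmod (f t n) \<le> c n"
    by (auto simp: dominated_curve_def)
  have "nrm ell2 (f t) \<le> nrm ell2 (\<lambda>n. complex_of_real (c n))" if "t \<in> {0..T}" for t
    by (rule ell2_mono) (use c that in \<open>auto simp: mem_ell2 intro: order_trans[OF _ abs_ge_self]\<close>)
  then show thesis by (rule that)
qed

lemma dominated_curve_L2:
  assumes f: "dominated_curve T f"
  shows "f \<in> L2 T ell2" and "(\<lambda>t. riesz (f t)) \<in> L2 T ell2'"
proof -
  interpret finite_measure "interval_measure T" by (rule finite_measure_interval)
  obtain B where B: "\<And>t. t \<in> {0..T} \<Longrightarrow> nrm ell2 (f t) \<le> B"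
    using dominated_curve_bounded[OF f] by blast
  have meas: "(\<lambda>t. (nrm ell2 (f t))\<^sup>2) \<in> borel_measurable (interval_measure T)"
    by (intro borel_measurable_power borel_measurable_nrm dominated_curve_measurable[OF f])
  have int: "integrable (interval_measure T) (\<lambda>t. (nrm ell2 (f t))\<^sup>2)"
    by (rule integrable_const_bound[OF AE_I2 meas, of "B\<^sup>2"])
       (use B dominated_curve_mem[OF f] nrm_ell2_nonneg in \<open>auto intro!: power_mono\<close>)
  then show "f \<in> L2 T ell2"
    by (simp add: L2_def dominated_curve_strongly_measurable[OF f])
  have "integrable (interval_measure T) (\<lambda>t. (nrm ell2' (riesz (f t)))\<^sup>2)"
    using int by (subst Bochner_Integration.integrable_cong[OF refl])
      (auto simp: nrm_riesz dominated_curve_mem[OF f])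
  then show "(\<lambda>t. riesz (f t)) \<in> L2 T ell2'"
    by (simp add: L2_def riesz.strongly_measurable_R dominated_curve_strongly_measurable[OF f])
qed

text \<open>
  The \<open>n\<close>-th coordinates of the simple integrals converge by dominated convergence in \<open>t\<close>. They are
  bounded by the length of the interval times the bound for the \<open>n\<close>-th coordinate of the curve, which
  makes the convergence one in norm.
\<close>

lemma dominated_curve_integral:
  assumes f: "dominated_curve T f"
  shows "(\<lambda>n. \<integral>t. f t n \<partial>interval_measure T) \<in> carrier ell2" (is "?x \<in> _")
    and "has_carrier_integral (interval_measure T) ell2 f (\<lambda>n. \<integral>t. f t n \<partial>interval_measure T)"
proof -
  interpret finite_measure "interval_measure T" by (rule finite_measure_interval)
  let ?M = "interval_measure T"
  obtain s where s: "\<And>i. carrier_simple ?M ell2 (s i)"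
    "\<And>t. t \<in> {0..T} \<Longrightarrow> (\<lambda>i. nrm ell2 (\<lambda>n. s i t n - f t n)) \<longlonglongrightarrow> 0"
    "\<And>i t. t \<in> {0..T} \<Longrightarrow> s i t \<in> f ` {0..T}"
    using dominated_curve_steps[OF f] by blast
  note s' = simple_coordinate[OF finite_measure_axioms s(1)]
  obtain c where c: "summable (\<lambda>n. (c n)\<^sup>2)" "\<And>t n. t \<in> {0..T} \<Longrightarrow> cmod (f t n) \<le> c n"
    using f by (auto simp: dominated_curve_def)
  have sc: "cmod (s i t n) \<le> c n" if "t \<in> {0..T}" for i t n
    using s(3)[OF that, of i] c(2) by auto
  have smem: "s i t \<in> carrier ell2" if "t \<in> {0..T}" for i t
    using s(3)[OF that, of i] dominated_curve_mem[OF f] by auto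
  note fmem = dominated_curve_mem[OF f]
  have lim_coord: "(\<lambda>i. s i t n) \<longlonglongrightarrow> f t n" if t: "t \<in> {0..T}" for t n
    by (rule coordinate_tendsto)
       (use s(2) t smem fmem in \<open>auto simp: ell2.limitin_iff ell2_a_minus\<close>)
  define L where "L = measure ?M (space ?M)"
  have int: "integrable ?M (\<lambda>t. g t)" and bound: "cmod (\<integral>t. g t \<partial>?M) \<le> L * C"
    if "g \<in> borel_measurable ?M" "\<And>t. t \<in> {0..T} \<Longrightarrow> cmod (g t) \<le> C" for g C
  proof -
    show int: "integrable ?M (\<lambda>t. g t)"
      by (rule integrable_const_bound[OF AE_I2 that(1)]) (use that(2) in auto)
    have "cmod (\<integral>t. g t \<partial>?M) \<le> (\<integral>t. cmod (g t) \<partial>?M)" by (rule integral_norm_bound)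
    also have "\<dots> \<le> (\<integral>t. C \<partial>?M)"
      by (rule integral_mono) (use int that(2) in auto)
    finally show "cmod (\<integral>t. g t \<partial>?M) \<le> L * C" by (simp add: L_def)
  qed
  have x_le: "cmod (?x n) \<le> L * c n" for n
    by (rule bound) (use c dominated_curve_measurable[OF f] in auto)
  show x: "?x \<in> carrier ell2"
    by (rule ell2_mono[of "\<lambda>n. complex_of_real (L * c n)"])
       (use c in \<open>auto simp: mem_ell2 power_mult_distrib norm_mult abs_mult[symmetric] intro!: summable_mult order_trans[OF x_le abs_ge_self]\<close>)
  have lim: "(\<lambda>i. \<integral>t. s i t n \<partial>?M) \<longlonglongrightarrow> ?x n" for n
  proof (rule integral_dominated_convergence)
    show "integrable ?M (\<lambda>t. c n)" by simp
  qed (use s'(1) sc lim_coord dominated_curve_measurable[OF f] in \<open>auto intro!: AE_I2\<close>)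
  have "(\<lambda>i. nrm ell2 (\<lambda>n. simple_integral ?M ell2 (s i) n - ?x n)) \<longlonglongrightarrow> 0"
  proof (rule nrm_tendsto_0)
    show "(\<lambda>i. simple_integral ?M ell2 (s i) n - ?x n) \<longlonglongrightarrow> 0" for n
      using lim by (simp add: s' LIM_zero)
    have "cmod (simple_integral ?M ell2 (s i) n - ?x n) \<le> 2 * L * c n" for i n
    proof -
      have "cmod (simple_integral ?M ell2 (s i) n) \<le> L * c n"
        unfolding s' by (rule bound) (use sc s'(1) in auto)
      then show ?thesis
        using norm_triangle_ineq4[of "simple_integral ?M ell2 (s i) n" "?x n"] x_le[of n] by linarith
    qed
    then show "\<forall>\<^sub>F i in sequentially. \<forall>n. cmod (simple_integral ?M ell2 (s i) n - ?x n) \<le> 2 * L * c n"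
      by simp
    show "summable (\<lambda>n. (2 * L * c n)\<^sup>2)"
      using c(1) by (simp add: power_mult_distrib summable_mult)
  qed
  then have *: "limitin (ntop ell2) (\<lambda>i. simple_integral ?M ell2 (s i)) ?x sequentially"
    by (simp add: ell2.limitin_iff x s' ell2_a_minus)
  have eq: "nrm ell2 (f t \<ominus>\<^bsub>ell2\<^esub> s i t) = nrm ell2 (\<lambda>n. s i t n - f t n)" if "t \<in> {0..T}" for t i
    using ell2_uminus(2)[OF ell2_diff[OF fmem[OF that] smem[OF that]]] by (simp add: ell2_a_minus smem[OF that])
  obtain B where B: "\<And>t. t \<in> {0..T} \<Longrightarrow> nrm ell2 (f t) \<le> B"
    using dominated_curve_bounded[OF f] by blast
  have "(\<lambda>i. \<integral>\<^sup>+t. ennreal (nrm ell2 (\<lambda>n. s i t n - f t n)) \<partial>?M) \<longlonglongrightarrow> (\<integral>\<^sup>+t. 0 \<partial>?M)"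
  proof (rule nn_integral_dominated_convergence)
    show "(\<lambda>t. ennreal (nrm ell2 (\<lambda>n. s i t n - f t n))) \<in> borel_measurable ?M" for i
      using s'(1) dominated_curve_measurable[OF f]
      by (intro measurable_compose[OF borel_measurable_nrm measurable_ennreal] borel_measurable_diff) auto
    show "AE t in ?M. ennreal (nrm ell2 (\<lambda>n. s i t n - f t n)) \<le> ennreal (2 * B)" for i
    proof (rule AE_I2, rule ennreal_leI)
      fix t assume "t \<in> space ?M"
      then have t: "t \<in> {0..T}" by simp
      obtain r where r: "r \<in> {0..T}" "s i t = f r" using s(3)[OF t, of i] by auto
      then show "nrm ell2 (\<lambda>n. s i t n - f t n) \<le> 2 * B"
        using ell2_add(2)[OF fmem[OF r(1)] ell2_uminus(1)[OF fmem[OF t]]] B[OF r(1)] B[OF t]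
        by (simp add: ell2_uminus fmem[OF t])
    qed
    show "AE t in ?M. (\<lambda>i. ennreal (nrm ell2 (\<lambda>n. s i t n - f t n))) \<longlonglongrightarrow> 0"
      using s(2) by (intro AE_I2) (auto simp: ennreal_tendsto_0_iff nrm_ell2_nonneg ell2_diff smem fmem)
    show "(\<integral>\<^sup>+ t. ennreal (2 * B) \<partial>?M) < \<infinity>"
      unfolding nn_integral_const infinity_ennreal_def ennreal_mult_less_top
      by (intro disjI2 conjI ennreal_less_top le_neq_trans[OF top_greatest emeasure_finite])
  qed auto
  then have "(\<lambda>i. \<integral>\<^sup>+t. ennreal (nrm ell2 (f t \<ominus>\<^bsub>ell2\<^esub> s i t)) \<partial>?M) \<longlonglongrightarrow> 0"
    using nn_integral_cong[of ?M "\<lambda>t. ennreal (nrm ell2 (f t \<ominus>\<^bsub>ell2\<^esub> s _ t))" "\<lambda>t. ennreal (nrm ell2 (\<lambda>n. s _ t n - f t n))"]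
    by (simp add: eq cong: nn_integral_cong)
  then show "has_carrier_integral ?M ell2 f ?x"
    unfolding has_carrier_integral_def using * s(1) dominated_curve_strongly_measurable[OF f] by blast
qed

text \<open>
  Pointwise, the coordinates of a square-summable sequence tend to 0, and
  \<open>1 + (nrm ell2 (g t))\<^sup>2\<close> is an integrable bound for all of them.
\<close>

lemma coordinates_integral_tendsto_0:
  assumes g: "g \<in> L2 T ell2"
  shows "integrable (interval_measure T) (\<lambda>t. g t n)"
    and "(\<lambda>n. \<integral>t. cmod (g t n) \<partial>interval_measure T) \<longlonglongrightarrow> 0"
proof -
  let ?M = "interval_measure T"
  have gm: "g t \<in> carrier ell2" if "t \<in> space ?M" for t
    using g that by (auto simp: L2_def strongly_measurable_def)
  have meas: "(\<lambda>t. g t n) \<in> borel_measurable ?M" for n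
    using g by (intro strongly_measurable_coordinate) (simp add: L2_def)
  have int: "integrable ?M (\<lambda>t. 1 + (nrm ell2 (g t))\<^sup>2)"
    using g by (simp add: L2_def)
  have le: "cmod (g t n) \<le> 1 + (nrm ell2 (g t))\<^sup>2" if "t \<in> space ?M" for t n
  proof -
    have "2 * nrm ell2 (g t) \<le> 1 + (nrm ell2 (g t))\<^sup>2"
      using zero_le_power2[of "nrm ell2 (g t) - 1"] by (simp add: power2_diff)
    then show ?thesis using cmod_le_nrm[OF gm[OF that], of n] nrm_ell2_nonneg[OF gm[OF that]] by linarith
  qed
  show "integrable ?M (\<lambda>t. g t n)"
    by (rule Bochner_Integration.integrable_bound[OF int meas], rule AE_I2)
       (use le in \<open>auto intro: order_trans[OF _ abs_ge_self]\<close>)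
  have "(\<lambda>n. \<integral>t. cmod (g t n) \<partial>?M) \<longlonglongrightarrow> (\<integral>t. 0 \<partial>?M)"
  proof (rule integral_dominated_convergence[OF _ _ int])
    show "AE t in ?M. (\<lambda>n. cmod (g t n)) \<longlonglongrightarrow> 0"
    proof (rule AE_I2)
      fix t assume "t \<in> space ?M"
      then have "(\<lambda>n. (cmod (g t n))\<^sup>2) \<longlonglongrightarrow> 0"
        using gm by (intro summable_LIMSEQ_zero) (simp add: mem_ell2)
      from tendsto_real_sqrt[OF this] show "(\<lambda>n. cmod (g t n)) \<longlonglongrightarrow> 0" by simp
    qed
  qed (use meas le in \<open>auto intro!: AE_I2\<close>)
  then show "(\<lambda>n. \<integral>t. cmod (g t n) \<partial>?M) \<longlonglongrightarrow> 0" by simp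
qed

section \<open>Weak derivatives by integration by parts\<close>

lemma power2_power2: "((2::real) ^ n)\<^sup>2 = 4 ^ n"
  by (simp add: power2_eq_square flip: power_mult_distrib)

lemma dominated_curveI:
  assumes "\<And>n. continuous_on {0..T} (\<lambda>t. f t n)" "\<And>t n. t \<in> {0..T} \<Longrightarrow> cmod (f t n) \<le> B * (1/2) ^ n"
  shows "dominated_curve T f"
  unfolding dominated_curve_def
proof (intro conjI allI exI ballI)
  have "(\<lambda>n. (B * (1/2) ^ n)\<^sup>2) = (\<lambda>n. B\<^sup>2 * (1/4) ^ n)"
    by (simp add: power_mult_distrib power_divide power2_power2)
  then show "summable (\<lambda>n. (B * (1/2) ^ n)\<^sup>2)" by (simp add: summable_mult)
qed (use assms in auto)

lemma dominated_curve_times: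
  assumes f: "dominated_curve T f" and g: "continuous_on {0..T} g"
  shows "dominated_curve T (\<lambda>t n. complex_of_real (g t) * f t n)"
proof -
  obtain c where c: "summable (\<lambda>n. (c n)\<^sup>2)" "\<And>t n. t \<in> {0..T} \<Longrightarrow> cmod (f t n) \<le> c n"
    using f by (auto simp: dominated_curve_def)
  obtain B where B: "\<And>t. t \<in> {0..T} \<Longrightarrow> \<bar>g t\<bar> \<le> B" "B > 0"
    using compact_imp_bounded[OF compact_continuous_image[OF g compact_Icc]]
    unfolding bounded_pos by (metis imageI real_norm_def)
  have "cmod (complex_of_real (g t) * f t n) \<le> B * c n" if "t \<in> {0..T}" for t n
    using B c(2)[OF that] that by (auto simp: norm_mult intro!: mult_mono)
  moreover have "summable (\<lambda>n. (B * c n)\<^sup>2)"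
    using c(1) by (simp add: power_mult_distrib summable_mult)
  moreover have "continuous_on {0..T} (\<lambda>t. complex_of_real (g t) * f t n)" for n
    using f g by (auto simp: dominated_curve_def intro!: continuous_intros)
  ultimately show ?thesis
    unfolding dominated_curve_def by (intro conjI allI exI[of _ "\<lambda>n. B * c n"] ballI) simp_all
qed

lemma test_function_deriv:
  assumes "test_function T \<phi>"
  shows "(\<phi> has_real_derivative deriv \<phi> t) (at t)" "continuous_on S \<phi>" "continuous_on S (deriv \<phi>)"
    "\<phi> 0 = 0" "\<phi> T = 0"
proof -
  have "(deriv ^^ 0) \<phi> differentiable (at t)" "(deriv ^^ 1) \<phi> differentiable (at t)" for t
    using assms unfolding test_function_def by blast+
  then have d: "\<phi> differentiable (at t)" "deriv \<phi> differentiable (at t)" for t by auto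
  show "(\<phi> has_real_derivative deriv \<phi> t) (at t)"
    using d(1) by (simp add: DERIV_deriv_iff_real_differentiable)
  show "continuous_on S \<phi>" "continuous_on S (deriv \<phi>)"
    by (intro continuous_at_imp_continuous_on ballI differentiable_imp_continuous_within d)+
  have "closure {t. \<phi> t \<noteq> 0} \<subseteq> {0<..<T}"
    using assms unfolding test_function_def by blast
  then have "{t. \<phi> t \<noteq> 0} \<subseteq> {0<..<T}"
    by (rule order_trans[OF closure_subset])
  from subsetD[OF this, of 0] subsetD[OF this, of T] show "\<phi> 0 = 0" "\<phi> T = 0"
    by auto
qed

lemma test_function_by_parts:
  fixes h h' :: "real \<Rightarrow> complex"
  assumes \<phi>: "test_function T \<phi>" and T: "0 \<le> T"
    and h: "\<And>t. (h has_vector_derivative h' t) (at t)" "continuous_on {0..T} h'"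
  shows "(\<integral>t. of_real (deriv \<phi> t) * h t \<partial>interval_measure T)
    = - (\<integral>t. of_real (\<phi> t) * h' t \<partial>interval_measure T)"
proof -
  note \<phi>' = test_function_deriv[OF \<phi>]
  have hc: "continuous_on {0..T} h"
    using h(1) by (auto intro!: continuous_at_imp_continuous_on has_vector_derivative_continuous)
  have int: "integrable (interval_measure T) (\<lambda>t. of_real (deriv \<phi> t) * h t)"
    "integrable (interval_measure T) (\<lambda>t. of_real (\<phi> t) * h' t)"
    by (intro continuous_imp_integrable_real continuous_intros \<phi>' hc h)+
  have "((\<lambda>t. of_real (\<phi> t) * h' t + of_real (deriv \<phi> t) * h t) has_integral
      of_real (\<phi> T) * h T - of_real (\<phi> 0) * h 0) {0..T}"
  proof (rule fundamental_theorem_of_calculus[OF T])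
    fix t
    from has_vector_derivative_mult[OF has_vector_derivative_of_real[OF \<phi>'(1)] h(1)]
    show "((\<lambda>t. of_real (\<phi> t) * h t) has_vector_derivative of_real (\<phi> t) * h' t + of_real (deriv \<phi> t) * h t) (at t within {0..T})"
      by (rule has_vector_derivative_at_within)
  qed
  then have "integral {0..T} (\<lambda>t. of_real (\<phi> t) * h' t + of_real (deriv \<phi> t) * h t) = 0"
    by (simp add: \<phi>' integral_unique)
  then have "(\<integral>t. of_real (\<phi> t) * h' t + of_real (deriv \<phi> t) * h t \<partial>interval_measure T) = 0"
    using int by (subst lebesgue_integral_eq_integral) auto
  then show ?thesis using int by (simp add: add_eq_0_iff)
qed

text \<open>
  The derivative is only required coordinatewise; the uniform bounds on the coordinates replace
  differentiability in norm.
\<close>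

lemma weak_derivative_ell2:
  assumes T: "0 \<le> T" and z: "dominated_curve T z" and z': "dominated_curve T z'"
    and deriv: "\<And>t n. ((\<lambda>t. z t n) has_vector_derivative z' t n) (at t)"
  shows "weak_derivative T ell2 z z'"
  unfolding weak_derivative_def
proof (intro allI impI)
  fix \<phi> assume \<phi>: "test_function T \<phi>"
  have 1: "dominated_curve T (\<lambda>t n. complex_of_real (deriv \<phi> t) * z t n)"
    and 2: "dominated_curve T (\<lambda>t n. complex_of_real (\<phi> t) * z' t n)"
    by (intro dominated_curve_times z z' test_function_deriv[OF \<phi>])+
  let ?y = "\<lambda>n. \<integral>t. of_real (\<phi> t) * z' t n \<partial>interval_measure T"
  have y: "?y \<in> carrier ell2" by (rule dominated_curve_integral(1)[OF 2])
  have "(\<lambda>n. - ?y n) = (\<lambda>n. \<integral>t. of_real (deriv \<phi> t) * z t n \<partial>interval_measure T)"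
    using z' by (intro ext test_function_by_parts[OF \<phi> T deriv, symmetric]) (auto simp: dominated_curve_def)
  then have "\<ominus>\<^bsub>ell2\<^esub> ?y = (\<lambda>n. \<integral>t. of_real (deriv \<phi> t) * z t n \<partial>interval_measure T)"
    by (simp add: ell2_a_inv y)
  then show "\<exists>y\<in>carrier ell2.
      has_carrier_integral (interval_measure T) ell2 (\<lambda>t. of_real (deriv \<phi> t) \<odot>\<^bsub>ell2\<^esub> z t) (\<ominus>\<^bsub>ell2\<^esub> y) \<and>
      has_carrier_integral (interval_measure T) ell2 (\<lambda>t. of_real (\<phi> t) \<odot>\<^bsub>ell2\<^esub> z' t) y"
    using dominated_curve_integral(2)[OF 1] dominated_curve_integral(2)[OF 2] y
    by (intro bexI[of _ ?y]) simp_all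
qed

text \<open>
  A weak derivative in \<open>ell2\<close> is tested against \<open>\<phi>\<close> in a single coordinate, where it has to
  agree with a classical derivative.
\<close>

lemma weak_derivative_coordinate:
  assumes weak: "weak_derivative T ell2 u g" and \<phi>: "test_function T \<phi>" and T: "0 \<le> T"
    and h: "\<And>t. ((\<lambda>t. u t n) has_vector_derivative h' t) (at t)" "continuous_on {0..T} h'"
    and g: "integrable (interval_measure T) (\<lambda>t. of_real (\<phi> t) * g t n)"
  shows "(\<integral>t. of_real (\<phi> t) * g t n \<partial>interval_measure T) = (\<integral>t. of_real (\<phi> t) * h' t \<partial>interval_measure T)"
proof -
  from weak \<phi> obtain y where y: "y \<in> carrier ell2"
    and u: "has_carrier_integral (interval_measure T) ell2 (\<lambda>t n. of_real (deriv \<phi> t) * u t n) (\<ominus>\<^bsub>ell2\<^esub> y)"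
    and g': "has_carrier_integral (interval_measure T) ell2 (\<lambda>t n. of_real (\<phi> t) * g t n) y"
    unfolding weak_derivative_def by auto
  have "continuous_on {0..T} (\<lambda>t. u t n)"
    by (intro continuous_at_imp_continuous_on ballI has_vector_derivative_continuous[OF h(1)])
  then have "integrable (interval_measure T) (\<lambda>t. of_real (deriv \<phi> t) * u t n)"
    by (intro continuous_imp_integrable_real continuous_intros test_function_deriv[OF \<phi>])
  from has_carrier_integral_coordinate[OF u finite_measure_interval this]
  have "- y n = (\<integral>t. of_real (deriv \<phi> t) * u t n \<partial>interval_measure T)"
    by (simp add: ell2_a_inv y)
  also have "\<dots> = - (\<integral>t. of_real (\<phi> t) * h' t \<partial>interval_measure T)"
    by (rule test_function_by_parts[OF \<phi> T h])
  finally show ?thesis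
    using has_carrier_integral_coordinate[OF g' finite_measure_interval g] by simp
qed

section \<open>Smooth functions of compact support\<close>

text \<open>
  The classical flat function \<open>exp (- 1 / t)\<close>, together with polynomials in \<open>1 / t\<close> as factors:
  this family is closed under differentiation, which yields all higher derivatives at once.
\<close>

definition flat :: "real poly \<Rightarrow> real \<Rightarrow> real" where
  "flat p t = (if 0 < t then poly p (inverse t) * exp (- inverse t) else 0)"

lemma flat_deriv: "(flat p has_real_derivative flat (monom 1 2 * (p - pderiv p)) t) (at t)"
proof (cases "t = 0")
  case False
  show ?thesis
  proof (cases "t < 0")
    case True
    have "((\<lambda>t. 0) has_real_derivative 0) (at t)" by simp
    then have "(flat p has_real_derivative 0) (at t)"
      by (rule DERIV_cong_ev[OF refl _ refl, THEN iffD1, rotated])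
         (rule eventually_mono[OF eventually_nhds_in_open[of "{..<0}"]], use True in \<open>auto simp: flat_def\<close>)
    with True show ?thesis by (simp add: flat_def)
  next
    case False
    with \<open>t \<noteq> 0\<close> have t: "t > 0" by simp
    have "((\<lambda>t. poly p (inverse t) * exp (- inverse t)) has_real_derivative
        poly (monom 1 2 * (p - pderiv p)) (inverse t) * exp (- inverse t)) (at t)"
      using t by (auto intro!: derivative_eq_intros simp: poly_monom power2_eq_square algebra_simps)
    then have "(flat p has_real_derivative
        poly (monom 1 2 * (p - pderiv p)) (inverse t) * exp (- inverse t)) (at t)"
      by (rule DERIV_cong_ev[OF refl _ refl, THEN iffD1, rotated])
         (rule eventually_mono[OF eventually_nhds_in_open[of "{0<..}"]], use t in \<open>auto simp: flat_def\<close>)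
    with t show ?thesis by (simp add: flat_def)
  qed
next
  case True
  have lim: "((\<lambda>x. x ^ k * exp (- x)) \<longlongrightarrow> (0::real)) at_top" for k
    using tendsto_power_div_exp_0[of k] by (simp add: exp_minus field_simps)
  have lim_poly: "((\<lambda>x. poly q x * exp (- x)) \<longlongrightarrow> (0::real)) at_top" for q
  proof -
    have "((\<lambda>x. \<Sum>i\<le>degree q. coeff q i * (x ^ i * exp (- x))) \<longlongrightarrow> (\<Sum>i\<le>degree q. coeff q i * 0)) at_top"
      by (intro tendsto_intros lim)
    then show ?thesis by (simp add: poly_altdef sum_distrib_right mult.assoc)
  qed
  have "((\<lambda>h. poly (monom 1 1 * p) (inverse h) * exp (- inverse h)) \<longlongrightarrow> 0) (at_right 0)"
    by (rule filterlim_compose[OF lim_poly filterlim_inverse_at_top_right])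
  then have "((\<lambda>h. flat p h / h) \<longlongrightarrow> 0) (at_right 0)"
    by (rule Lim_transform_eventually)
       (auto simp: eventually_at_right_field flat_def poly_monom field_simps intro!: exI[of _ 1])
  moreover have "((\<lambda>h. flat p h / h) \<longlongrightarrow> 0) (at_left 0)"
    by (rule tendsto_eventually) (auto simp: eventually_at_left_field flat_def intro!: exI[of _ "-1"])
  ultimately have "((\<lambda>h. flat p h / h) \<longlongrightarrow> 0) (at 0)"
    by (simp add: filterlim_split_at)
  then have "(flat p has_real_derivative 0) (at 0)"
    by (simp add: DERIV_def flat_def)
  with True show ?thesis by (simp add: flat_def)
qed

text \<open>
  This set contains with each function its derivative, so that all higher derivatives exist by
  induction. Sines and cosines are included for the sake of modulated bump functions.
\<close>

inductive_set elem_smooth :: "(real \<Rightarrow> real) set" where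
  const: "(\<lambda>t. c) \<in> elem_smooth"
| flat: "(\<lambda>t. flat p (c * t + d)) \<in> elem_smooth"
| sin: "(\<lambda>t. sin (c * t)) \<in> elem_smooth"
| cos: "(\<lambda>t. cos (c * t)) \<in> elem_smooth"
| add: "\<lbrakk>f \<in> elem_smooth; g \<in> elem_smooth\<rbrakk> \<Longrightarrow> (\<lambda>t. f t + g t) \<in> elem_smooth"
| mult: "\<lbrakk>f \<in> elem_smooth; g \<in> elem_smooth\<rbrakk> \<Longrightarrow> (\<lambda>t. f t * g t) \<in> elem_smooth"

lemma elem_smooth_deriv:
  assumes "f \<in> elem_smooth"
  shows "\<exists>g\<in>elem_smooth. \<forall>t. (f has_real_derivative g t) (at t)"
  using assms
proof induction
  case (const c)
  show ?case by (rule bexI[OF _ elem_smooth.const[of 0]]) simp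
next
  case (flat p c d)
  have "((\<lambda>t. flat p (c * t + d)) has_real_derivative
      c * flat (monom 1 2 * (p - pderiv p)) (c * t + d)) (at t)" for t
    by (rule DERIV_cong[OF DERIV_chain2[OF flat_deriv]]) (auto intro!: derivative_eq_intros)
  then show ?case
    by (intro bexI[OF _ elem_smooth.mult[OF elem_smooth.const[of c] elem_smooth.flat]] allI)
next
  case (sin c)
  show ?case
    by (rule bexI[OF _ elem_smooth.mult[OF elem_smooth.const[of c] elem_smooth.cos[of c]]])
       (auto intro!: derivative_eq_intros)
next
  case (cos c)
  show ?case
    by (rule bexI[OF _ elem_smooth.mult[OF elem_smooth.const[of "-c"] elem_smooth.sin[of c]]])
       (auto intro!: derivative_eq_intros)
next
  case (add f g)
  then obtain f' g' where "f' \<in> elem_smooth" "g' \<in> elem_smooth"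
    "\<And>t. (f has_real_derivative f' t) (at t)" "\<And>t. (g has_real_derivative g' t) (at t)" by blast
  then show ?case
    by (intro bexI[OF _ elem_smooth.add[of f' g']]) (auto intro!: derivative_eq_intros)
next
  case (mult f g)
  then obtain f' g' where "f' \<in> elem_smooth" "g' \<in> elem_smooth"
    "\<And>t. (f has_real_derivative f' t) (at t)" "\<And>t. (g has_real_derivative g' t) (at t)" by blast
  with mult show ?case
    by (intro bexI[OF _ elem_smooth.add[OF elem_smooth.mult[of f' g] elem_smooth.mult[of g' f]]])
       (auto intro!: derivative_eq_intros)
qed

lemma elem_smooth_differentiable:
  assumes "f \<in> elem_smooth"
  shows "(deriv ^^ n) f differentiable (at t)"
proof -
  have deriv: "deriv g \<in> elem_smooth" if g: "g \<in> elem_smooth" for g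
  proof -
    from elem_smooth_deriv[OF g] obtain g' where "g' \<in> elem_smooth" "\<And>t. (g has_real_derivative g' t) (at t)"
      by blast
    moreover from this have "deriv g = g'" by (auto intro!: DERIV_imp_deriv)
    ultimately show ?thesis by simp
  qed
  have "(deriv ^^ n) f \<in> elem_smooth"
    by (induction n) (auto simp: assms deriv)
  from elem_smooth_deriv[OF this] show ?thesis
    by (auto simp: real_differentiable_def)
qed

definition bump :: "real \<Rightarrow> real" where
  "bump t = flat 1 (4 * t - 1) * flat 1 (3 - 4 * t)"

lemma bump_pos_iff: "0 < bump t \<longleftrightarrow> 1/4 < t \<and> t < 3/4"
  and bump_nonneg: "0 \<le> bump t"
  by (auto simp: bump_def flat_def)

lemma bump_elem_smooth: "bump \<in> elem_smooth"
  using elem_smooth.mult[OF elem_smooth.flat[of 1 4 "-1"] elem_smooth.flat[of 1 "-4" 3]]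
  by (simp add: bump_def[abs_def] algebra_simps)

lemma test_function_bump_times:
  assumes "f \<in> elem_smooth"
  shows "test_function 1 (\<lambda>t. bump t * f t)"
proof -
  have sub: "closure {t. bump t * f t \<noteq> 0} \<subseteq> {1/4..3/4}"
    using bump_pos_iff bump_nonneg by (intro closure_minimal) (force simp: less_le)+
  then have "compact (closure {t. bump t * f t \<noteq> 0})"
    by (meson bounded_subset bounded_closed_interval closed_closure compact_eq_bounded_closed)
  moreover have "{1/4..3/4} \<subseteq> {0<..<1::real}" by auto
  ultimately show ?thesis
    unfolding test_function_def using sub elem_smooth_differentiable[OF elem_smooth.mult[OF bump_elem_smooth assms]]
    by blast
qed

lemma bump_le_1: "bump t \<le> 1"
  by (auto simp: bump_def flat_def intro!: mult_le_one)

lemma bump_continuous: "continuous_on S bump"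
  using test_function_deriv(2)[OF test_function_bump_times[OF elem_smooth.const[of 1]], of S] by simp

lemma integral_bump_pos: "0 < (\<integral>t. bump t * t \<partial>interval_measure 1)"
proof -
  have "(\<integral>t. bump t * t \<partial>interval_measure 1) \<noteq> 0"
  proof
    assume "(\<integral>t. bump t * t \<partial>interval_measure 1) = 0"
    then have "\<forall>t\<in>{0..1}. bump t * t = 0"
      by (subst (asm) integralL_eq_0_iff) (auto intro!: continuous_intros bump_continuous simp: bump_nonneg)
    then have "bump (1/2) * (1/2) = 0" by (rule bspec) simp
    then show False using bump_pos_iff[of "1/2"] by simp
  qed
  moreover have "0 \<le> (\<integral>t. bump t * t \<partial>interval_measure 1)"
    by (intro integral_nonneg_AE AE_I2) (simp add: bump_nonneg)
  ultimately show ?thesis by simp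
qed

section \<open>The form and its solution\<close>

definition e0 :: "nat \<Rightarrow> complex" where "e0 n = (if n = 0 then 1 else 0)"

text \<open>
  The coordinate 0 is reserved for \<open>e0\<close>, so that \<open>e0 + wave t\<close> has the constant coordinate 1 there.
\<close>

definition wave :: "real \<Rightarrow> nat \<Rightarrow> complex" where
  "wave t n = (if n = 0 then 0 else cis (4 ^ n * t) / 2 ^ n)"

text \<open>
  The embedding of \<open>V\<close> into \<open>H\<close>, in coordinates with respect to orthonormal bases of both spaces.
\<close>

definition emb :: "(nat \<Rightarrow> complex) \<Rightarrow> nat \<Rightarrow> complex" where
  "emb x n = x n / 2 ^ n"

text \<open>
  The Riesz map of \<open>V\<close> sends \<open>e0 + wave t\<close> to \<open>e0 + wave t\<close>; the perturbation subtracts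
  \<open>(1 + \<i>) * wave t\<close> since the coordinate 0 of \<open>e0 + wave t\<close> is 1.
\<close>

definition form :: "real \<Rightarrow> (nat \<Rightarrow> complex) \<Rightarrow> (nat \<Rightarrow> complex) \<Rightarrow> complex" where
  "form t x y = ip ell2 x y - (1 + \<i>) * x 0 * ip ell2 (wave t) y"

definition sol :: "real \<Rightarrow> nat \<Rightarrow> complex" where
  "sol t n = of_real t * (e0 n + wave t n)"

definition rhs :: "real \<Rightarrow> nat \<Rightarrow> complex" where
  "rhs t n = (1 + of_real t) * e0 n + wave t n / 2 ^ n"

lemma norm_wave: "(cmod (wave t n))\<^sup>2 = (if n = 0 then 0 else (1/4) ^ n)"
  by (simp add: wave_def norm_divide norm_power power_divide power2_power2)

lemma norm_wave_le: "cmod (wave t n) \<le> (1/2) ^ n"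
  by (simp add: wave_def norm_divide norm_power power_divide)

lemma wave_mem: "wave t \<in> carrier ell2" and nrm_wave: "nrm ell2 (wave t) = sqrt (1/3)"
proof -
  have "(\<lambda>n. (1/4::real) ^ Suc n) sums (1/3)"
    using sums_mult[OF geometric_sums[of "1/4::real"], of "1/4"] by simp
  then have "(\<lambda>n. (cmod (wave t (Suc n)))\<^sup>2) sums (1/3)" by (simp only: norm_wave) simp
  then have "(\<lambda>n. (cmod (wave t n))\<^sup>2) sums (1/3)"
    by (subst (asm) sums_Suc_iff) (simp add: norm_wave)
  then show "wave t \<in> carrier ell2" "nrm ell2 (wave t) = sqrt (1/3)"
    by (simp_all add: mem_ell2 nrm_ell2 sums_iff)
qed

lemma norm_emb_le: "cmod (emb x n) \<le> cmod (x n)"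
  using mult_left_mono[of 1 "2 ^ n" "cmod (x n)"] by (simp add: emb_def norm_divide norm_power divide_le_eq)

lemma emb_mem: "x \<in> carrier ell2 \<Longrightarrow> emb x \<in> carrier ell2"
  and nrm_emb: "x \<in> carrier ell2 \<Longrightarrow> nrm ell2 (emb x) \<le> nrm ell2 x"
  using ell2_mono[where x = "emb x" and y = x, OF _ norm_emb_le] by blast+

lemma e0_mem: "e0 \<in> carrier ell2"
  unfolding mem_ell2 by (rule summable_finite[of "{0}"]) (auto simp: e0_def)

lemma dense_embedding_emb: "dense_embedding UNIV ell2 ell2 emb"
  unfolding dense_embedding_def
proof (intro conjI)
  show "inj_on emb (carrier ell2)"
    by (auto simp: inj_on_def emb_def fun_eq_iff)
  have diff: "nrm ell2 (\<lambda>n. emb x n - emb y n) \<le> nrm ell2 (\<lambda>n. x n - y n)"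
    if "x \<in> carrier ell2" "y \<in> carrier ell2" for x y
    using nrm_emb[OF ell2_diff[OF that]] by (simp add: emb_def[abs_def] diff_divide_distrib)
  show "continuous_map (ntop ell2) (ntop ell2) emb"
    unfolding continuous_map_atin
  proof
    fix x assume "x \<in> topspace (ntop ell2)"
    then have x: "x \<in> carrier ell2" by simp
    have ev: "\<forall>\<^sub>F y in atin (ntop ell2) x. y \<in> carrier ell2 \<and> ndist ell2 y x < e" if "e > 0" for e
      using that x ell2.metric.limitin_metric[of "\<lambda>y. y" x "atin (ntop ell2) x"]
      by (auto simp: limitin_def eventually_atin)
    show "limitin (ntop ell2) emb (emb x) (atin (ntop ell2) x)"
      unfolding ell2.metric.limitin_metric
    proof (intro conjI allI impI emb_mem x)
      fix e :: real assume "0 < e"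
      from ev[OF this] show "\<forall>\<^sub>F y in atin (ntop ell2) x. emb y \<in> carrier ell2 \<and> ndist ell2 (emb y) (emb x) < e"
      proof eventually_elim
        case (elim y)
        then show ?case
          using x diff[of y x] by (auto simp: ndist_def ell2_a_minus emb_mem)
      qed
    qed
  qed
  show "ntop ell2 closure_of emb ` carrier ell2 = carrier ell2"
    unfolding ell2.metric.metric_closure_of
  proof (intro equalityI subsetI)
    fix x assume x: "x \<in> carrier ell2"
    \<comment> \<open>Truncations of \<open>x\<close> lie in the range of the embedding.\<close>
    define y where "y k n = (if n < k then 2 ^ n * x n else 0)" for k n
    have y: "y k \<in> carrier ell2" for k
      unfolding mem_ell2 y_def by (rule summable_finite[of "{..<k}"]) auto
    have "(\<lambda>k. nrm ell2 (\<lambda>n. x n - emb (y k) n)) \<longlonglongrightarrow> 0"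
    proof (rule nrm_tendsto_0)
      show "(\<lambda>k. x n - emb (y k) n) \<longlonglongrightarrow> 0" for n
        by (rule tendsto_eventually)
           (auto simp: emb_def y_def eventually_sequentially intro!: exI[of _ "Suc n"])
      show "\<forall>\<^sub>F k in sequentially. \<forall>n. cmod (x n - emb (y k) n) \<le> cmod (x n)"
        by (auto simp: emb_def y_def)
      show "summable (\<lambda>n. (cmod (x n))\<^sup>2)" using x by (simp add: mem_ell2)
    qed
    then have "\<exists>k. nrm ell2 (\<lambda>n. x n - emb (y k) n) < r" if "r > 0" for r
      using order_tendstoD(2)[OF _ that] eventually_happens'[OF sequentially_bot] by blast
    then have "\<exists>k. ndist ell2 x (emb (y k)) < r" if "r > 0" for r
      using that x y by (simp add: ndist_def emb_mem ell2_a_minus)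
    then show "x \<in> {x \<in> carrier ell2. \<forall>r>0. \<exists>y\<in>emb ` carrier ell2. y \<in> ell2.metric.mball x r}"
      using x y by (fastforce simp: emb_mem)
  qed auto
qed (auto simp: emb_mem, auto simp: emb_def add_divide_distrib)

text \<open>
  The constant is \<open>cmod (1 + \<i>) * nrm ell2 (wave t) = sqrt 2 * sqrt (1/3)\<close>. That it is below 1 is
  what makes the form coercive.
\<close>

lemma perturbation_le:
  assumes "x \<in> carrier ell2" "y \<in> carrier ell2"
  shows "cmod ((1 + \<i>) * x 0 * ip ell2 (wave t) y) \<le> sqrt (2/3) * nrm ell2 x * nrm ell2 y"
proof -
  have "cmod ((1 + \<i>) * x 0 * ip ell2 (wave t) y)
      \<le> sqrt 2 * nrm ell2 x * (sqrt (1/3) * nrm ell2 y)"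
    unfolding norm_mult using cmod_le_nrm[OF assms(1), of 0] ell2_ip(2)[OF wave_mem[of t] assms(2)]
    by (intro mult_mono) (auto simp: nrm_wave cmod_def nrm_ell2_nonneg assms)
  also have "sqrt 2 * nrm ell2 x * (sqrt (1/3) * nrm ell2 y) = sqrt (2/3) * nrm ell2 x * nrm ell2 y"
    by (simp add: real_sqrt_divide)
  finally show ?thesis .
qed

lemma wave_continuous: "continuous_on S (\<lambda>t. wave t n)"
  unfolding wave_def by (cases "n = 0") (auto intro!: continuous_intros)

lemma nonautonomous_form_form: "nonautonomous_form UNIV T ell2 form"
  unfolding nonautonomous_form_def
proof (intro conjI ballI)
  fix x y assume x: "x \<in> carrier ell2" and y: "y \<in> carrier ell2"
  have "(\<lambda>t. ip ell2 (wave t) y) \<in> borel_measurable (interval_measure T)"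
    unfolding ip_ell2
    by (intro borel_measurable_suminf borel_measurable_times borel_measurable_const
        continuous_imp_measurable_on_sets_lebesgue wave_continuous) auto
  then show "(\<lambda>t. form t x y) \<in> borel_measurable (interval_measure T)"
    unfolding form_def by (intro borel_measurable_diff borel_measurable_times borel_measurable_const)
next
  show "\<exists>M\<ge>0. \<forall>t\<in>{0..T}. \<forall>v\<in>carrier ell2. \<forall>w\<in>carrier ell2.
      cmod (form t v w) \<le> M * nrm ell2 v * nrm ell2 w"
  proof (intro exI conjI ballI)
    fix t v w assume v: "v \<in> carrier ell2" and w: "w \<in> carrier ell2"
    show "cmod (form t v w) \<le> (1 + sqrt (2/3)) * nrm ell2 v * nrm ell2 w"
      using norm_triangle_ineq4[of "ip ell2 v w" "(1 + \<i>) * v 0 * ip ell2 (wave t) w"]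
        perturbation_le[OF v w, of t] ell2_ip(2)[OF v w]
      unfolding form_def distrib_right by linarith
  qed simp_all
next
  fix t x y assume x: "x \<in> carrier ell2" and y: "y \<in> carrier ell2"
  show "form t (x \<oplus>\<^bsub>ell2\<^esub> z) y = form t x y + form t z y" if "z \<in> carrier ell2" for z
    using x y that unfolding form_def by (simp add: ip_ell2_add algebra_simps)
  show "form t (c \<odot>\<^bsub>ell2\<^esub> x) y = c * form t x y" for c
    using x y unfolding form_def by (simp add: ip_ell2_smult algebra_simps)
next
  fix t x assume x: "x \<in> carrier ell2"
  show "antilinear_on UNIV ell2 (form t x)"
    unfolding antilinear_on_def
  proof (intro conjI ballI)
    fix y assume y: "y \<in> carrier ell2"
    show "form t x (y \<oplus>\<^bsub>ell2\<^esub> z) = form t x y + form t x z" if "z \<in> carrier ell2" for z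
      using x y that unfolding form_def by (simp add: ip_ell2_add wave_mem algebra_simps)
    show "form t x (c \<odot>\<^bsub>ell2\<^esub> y) = cnj c * form t x y" for c
      using x y unfolding form_def by (simp add: ip_ell2_smult wave_mem algebra_simps)
  qed
qed simp_all

lemma coercive_form_form: "coercive_form T ell2 form"
  unfolding coercive_form_def
proof (intro exI conjI ballI)
  show "0 < 1 - sqrt (2/3)" by simp
  fix t v assume v: "v \<in> carrier ell2"
  have "Re ((1 + \<i>) * v 0 * ip ell2 (wave t) v) \<le> sqrt (2/3) * nrm ell2 v * nrm ell2 v"
    using perturbation_le[OF v v, of t] complex_Re_le_cmod order_trans by blast
  then show "(1 - sqrt (2/3)) * (nrm ell2 v)\<^sup>2 \<le> Re (form t v v)"
    unfolding form_def minus_complex.sel ip_self[OF v] Re_complex_of_real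
    by (simp add: power2_eq_square left_diff_distrib mult.assoc)
qed

lemma sol_mem: "sol t \<in> carrier ell2"
  using ell2_smult(1)[OF ell2_add(1)[OF e0_mem wave_mem[of t]], of "of_real t"] by (simp add: sol_def[abs_def])

lemma norm_e0_le: "cmod (e0 n) \<le> (1/2) ^ n"
  by (simp add: e0_def)

lemma dominated_sol: "dominated_curve 1 sol"
proof (rule dominated_curveI[where B = 2])
  show "continuous_on {0..1} (\<lambda>t. sol t n)" for n
    unfolding sol_def by (intro continuous_intros wave_continuous)
  fix t :: real and n assume t: "t \<in> {0..1}"
  have "cmod (sol t n) \<le> 1 * (cmod (e0 n) + cmod (wave t n))"
    unfolding sol_def norm_mult using t by (intro mult_mono norm_triangle_ineq) auto
  then have "cmod (sol t n) \<le> cmod (e0 n) + cmod (wave t n)" by simp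
  then show "cmod (sol t n) \<le> 2 * (1/2) ^ n"
    using norm_e0_le[of n] norm_wave_le[of t n] by linarith
qed

lemma dominated_emb:
  assumes "dominated_curve T f"
  shows "dominated_curve T (\<lambda>t. emb (f t))"
proof -
  obtain c where "summable (\<lambda>n. (c n)\<^sup>2)" "\<And>t n. t \<in> {0..T} \<Longrightarrow> cmod (f t n) \<le> c n"
    using assms by (auto simp: dominated_curve_def)
  moreover have "cmod (emb (f t) n) \<le> c n" if "t \<in> {0..T}" for t n
    using norm_emb_le calculation(2)[OF that] by (rule order_trans)
  moreover have "continuous_on {0..T} (\<lambda>t. emb (f t) n)" for n
    using assms unfolding dominated_curve_def emb_def by (intro continuous_intros) auto
  ultimately show ?thesis unfolding dominated_curve_def by blast
qed

lemma dominated_rhs: "dominated_curve 1 rhs"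
proof (rule dominated_curveI[where B = 3])
  show "continuous_on {0..1} (\<lambda>t. rhs t n)" for n
    unfolding rhs_def by (intro continuous_intros wave_continuous) simp
  fix t :: real and n assume t: "t \<in> {0..1}"
  have "cmod (wave t n / 2 ^ n) \<le> cmod (wave t n)"
    using norm_emb_le[of "wave t" n] by (simp add: emb_def)
  moreover have "cmod ((1 + of_real t) * e0 n) \<le> 2 * cmod (e0 n)"
    unfolding norm_mult using t norm_triangle_ineq[of 1 "complex_of_real t"] by (intro mult_right_mono) auto
  ultimately have "cmod (rhs t n) \<le> 2 * cmod (e0 n) + cmod (wave t n)"
    unfolding rhs_def using norm_triangle_ineq[of "(1 + of_real t) * e0 n" "wave t n / 2 ^ n"] by linarith
  then show "cmod (rhs t n) \<le> 3 * (1/2) ^ n"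
    using norm_e0_le[of n] norm_wave_le[of t n] by linarith
qed

text \<open>
  The Riesz representative of the derivative of the solution in \<open>V'\<close>.
\<close>

definition sol' :: "real \<Rightarrow> nat \<Rightarrow> complex" where
  "sol' t n = e0 n + wave t n / 4 ^ n + of_real t * \<i> * wave t n"

lemma sol'_mem: "sol' t \<in> carrier ell2"
proof -
  have "(\<lambda>n. e0 n + emb (emb (wave t)) n + of_real t * \<i> * wave t n) \<in> carrier ell2"
    by (intro ell2_add ell2_smult e0_mem emb_mem wave_mem)
  then show ?thesis by (simp add: sol'_def[abs_def] emb_def flip: power_mult_distrib)
qed

lemma dominated_sol': "dominated_curve 1 sol'"
proof (rule dominated_curveI[where B = 3])
  show "continuous_on {0..1} (\<lambda>t. sol' t n)" for n
    unfolding sol'_def by (intro continuous_intros wave_continuous) simp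
  fix t :: real and n assume t: "t \<in> {0..1}"
  have "cmod (wave t n / 4 ^ n) \<le> cmod (wave t n)"
    using order_trans[OF norm_emb_le[of "emb (wave t)" n] norm_emb_le[of "wave t" n]] by (simp add: emb_def flip: power_mult_distrib)
  moreover have "cmod (of_real t * \<i> * wave t n) \<le> cmod (wave t n)"
    using t by (simp add: norm_mult mult_left_le_one_le)
  ultimately have "cmod (sol' t n) \<le> cmod (e0 n) + cmod (wave t n) + cmod (wave t n)"
    unfolding sol'_def using norm_triangle_ineq[of "e0 n + wave t n / 4 ^ n" "of_real t * \<i> * wave t n"]
      norm_triangle_ineq[of "e0 n" "wave t n / 4 ^ n"] by linarith
  then show "cmod (sol' t n) \<le> 3 * (1/2) ^ n"
    using norm_e0_le[of n] norm_wave_le[of t n] by linarith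
qed

lemma wave_deriv: "((\<lambda>t. wave t n) has_vector_derivative \<i> * 4 ^ n * wave t n) (at t)"
proof (cases "n = 0")
  case False
  have "((\<lambda>t. cis (4 ^ n * t)) has_vector_derivative (4 ^ n *\<^sub>R (\<i> * cis (4 ^ n * t)))) (at t)"
    by (rule has_vector_derivative_eq_rhs[OF vector_diff_chain_at[where g = cis and f = "\<lambda>t. 4 ^ n * t", unfolded o_def]])
       (auto intro!: derivative_eq_intros simp: has_vector_derivative_def)
  from has_vector_derivative_divide[OF this, of "2 ^ n"] show ?thesis
    using False by (simp add: wave_def scaleR_conv_of_real mult_ac)
qed (simp add: wave_def)

lemma sol_deriv: "((\<lambda>t. sol t n) has_vector_derivative 4 ^ n * sol' t n) (at t)"
proof -
  have "((\<lambda>t. of_real t * (e0 n + wave t n)) has_vector_derivative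
      of_real t * (0 + \<i> * 4 ^ n * wave t n) + of_real 1 * (e0 n + wave t n)) (at t)"
    by (intro has_vector_derivative_mult has_vector_derivative_of_real has_vector_derivative_add
        has_vector_derivative_const wave_deriv DERIV_ident)
  moreover have "of_real t * (0 + \<i> * 4 ^ n * wave t n) + of_real 1 * (e0 n + wave t n) = 4 ^ n * sol' t n"
    by (cases "n = 0") (simp_all add: sol'_def e0_def algebra_simps)
  ultimately show ?thesis by (simp only: sol_def)
qed

text \<open>
  The embedding is diagonal with real entries, hence self-adjoint.
\<close>

lemma to_antidual_emb: "to_antidual ell2 ell2 emb h = riesz (emb h)"
  unfolding to_antidual_def riesz_def ip_ell2 emb_def by (simp add: mult.commute)

lemma sol_derivative_in_dual:
  "weak_derivative 1 ell2' (\<lambda>t. to_antidual ell2 ell2 emb (emb (sol t))) (\<lambda>t. riesz (sol' t))"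
  unfolding to_antidual_emb
proof (intro riesz.weak_derivative_R weak_derivative_ell2 dominated_emb dominated_sol dominated_sol' emb_mem sol_mem sol'_mem)
  show "((\<lambda>t. emb (emb (sol t)) n) has_vector_derivative sol' t n) (at t)" for t n
    using has_vector_derivative_divide[OF sol_deriv[of n t], of "4 ^ n"]
    by (simp add: emb_def flip: power_mult_distrib)
qed simp

text \<open>
  The contribution \<open>t * \<i> * wave t\<close>, which does not come from \<open>H\<close>, occurs in the derivative
  and, with the opposite sign, in the operator term.
\<close>

lemma sol_equation:
  "riesz (sol' t) \<oplus>\<^bsub>ell2'\<^esub> form_operator ell2 form t (sol t) = to_antidual ell2 ell2 emb (rhs t)"
proof -
  have t: "sol t 0 = of_real t" by (simp add: sol_def e0_def wave_def)
  have "form_operator ell2 form t (sol t) = riesz (\<lambda>n. sol t n + (- ((1 + \<i>) * of_real t)) * wave t n)"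
    unfolding form_operator_def riesz_def form_def t
    by (rule restrict_ext) (simp only: ip_ell2_add ip_ell2_smult sol_mem wave_mem ell2_smult, simp)
  then have "riesz (sol' t) \<oplus>\<^bsub>ell2'\<^esub> form_operator ell2 form t (sol t)
      = riesz (\<lambda>n. sol' t n + (sol t n + (- ((1 + \<i>) * of_real t)) * wave t n))"
    by (simp only:) (rule riesz_add[symmetric], intro sol'_mem, intro ell2_add ell2_smult sol_mem wave_mem)
  also have "(\<lambda>n. sol' t n + (sol t n + (- ((1 + \<i>) * of_real t)) * wave t n)) = emb (rhs t)"
  proof
    fix n
    have "rhs t n / 2 ^ n = (1 + of_real t) * e0 n + wave t n / 4 ^ n"
      by (simp add: rhs_def add_divide_distrib flip: power_mult_distrib) (simp add: e0_def)
    then show "sol' t n + (sol t n + (- ((1 + \<i>) * of_real t)) * wave t n) = emb (rhs t) n"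
      by (simp add: emb_def sol'_def sol_def algebra_simps)
  qed
  finally show ?thesis by (simp only: to_antidual_emb)
qed

lemma sol_solves:
  "solves_Cauchy_problem UNIV 1 ell2 ell2 emb form (\<lambda>t. to_antidual ell2 ell2 emb (rhs t)) \<zero>\<^bsub>ell2\<^esub> sol"
  unfolding solves_Cauchy_problem_def
proof (intro conjI bexI[of _ "\<lambda>t. riesz (sol' t)"])
  have "(\<lambda>t. to_antidual ell2 ell2 emb (emb (sol t))) \<in> L2 1 ell2'"
    unfolding to_antidual_emb by (intro dominated_curve_L2 dominated_emb dominated_sol)
  then show "sol \<in> MR UNIV 1 ell2 ell2 emb"
    unfolding MR_def H1_def
    using dominated_curve_L2(1)[OF dominated_sol] dominated_curve_L2(2)[OF dominated_sol'] sol_derivative_in_dual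
    by blast
  show "initial_value 1 ell2 (\<lambda>t. emb (sol t)) \<zero>\<^bsub>ell2\<^esub>"
    unfolding initial_value_def
    by (intro exI[of _ "\<lambda>t. emb (sol t)"] conjI dominated_curve_continuous dominated_emb dominated_sol)
       (auto simp: emb_def sol_def)
qed (use sol_equation in \<open>auto simp: sol_derivative_in_dual dominated_curve_L2 dominated_sol' simp del: antidual_ops\<close>)

section \<open>Failure of maximal regularity\<close>

text \<open>
  In \<open>H\<close> the \<open>n\<close>-th coordinate of the derivative is \<open>(1 / 4 ^ n + \<i> * t) * cis (4 ^ n * t)\<close>.
  Its modulus is at least \<open>t\<close> for all \<open>n > 0\<close>, so the derivative is not in \<open>H\<close> for any \<open>t > 0\<close>.
  Modulating a bump function removes the oscillation and makes this visible to test functions.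
\<close>

lemma sol_not_H1: "(\<lambda>t. emb (sol t)) \<notin> H1 1 ell2"
proof
  let ?M = "interval_measure 1"
  assume "(\<lambda>t. emb (sol t)) \<in> H1 1 ell2"
  then obtain g where g: "g \<in> L2 1 ell2" and weak: "weak_derivative 1 ell2 (\<lambda>t. emb (sol t)) g"
    by (auto simp: H1_def)
  have gint: "integrable ?M (\<lambda>t. of_real (c t) * g t n)" if c: "continuous_on {0..1} c" for c n
  proof -
    obtain B where B: "\<And>t. t \<in> {0..1} \<Longrightarrow> \<bar>c t\<bar> \<le> B"
      using compact_imp_bounded[OF compact_continuous_image[OF c compact_Icc]]
      unfolding bounded_iff by (metis imageI real_norm_def)
    show ?thesis
    proof (rule Bochner_Integration.integrable_bound)
      show "integrable ?M (\<lambda>t. of_real B * g t n)"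
        by (intro integrable_mult_right coordinates_integral_tendsto_0(1)[OF g])
      show "(\<lambda>t. of_real (c t) * g t n) \<in> borel_measurable ?M"
        by (intro borel_measurable_times borel_measurable_integrable[OF coordinates_integral_tendsto_0(1)[OF g]]
            continuous_imp_measurable_on_sets_lebesgue continuous_intros c) auto
      show "AE t in ?M. norm (of_real (c t) * g t n) \<le> norm (of_real B * g t n)"
        by (rule AE_I2) (use B in \<open>force simp: norm_mult intro!: mult_right_mono order_trans[OF _ abs_ge_self]\<close>)
    qed
  qed
  define h' where "h' n t = of_real (2 ^ n) * sol' t n" for n and t :: real
  have deriv: "((\<lambda>t. emb (sol t) n) has_vector_derivative h' n t) (at t)" for n t
  proof -
    have "(4::complex) ^ n = 2 ^ n * 2 ^ n" by (simp flip: power_mult_distrib)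
    then show ?thesis
      using has_vector_derivative_divide[OF sol_deriv[of n t], of "2 ^ n"] by (simp add: emb_def h'_def)
  qed
  have h'_cont: "continuous_on {0..1} (h' n)" for n
    unfolding h'_def sol'_def by (intro continuous_intros wave_continuous) simp
  have parts: "(\<integral>t. of_real (bump t * f t) * g t n \<partial>?M) = (\<integral>t. of_real (bump t * f t) * h' n t \<partial>?M)"
    if f: "f \<in> elem_smooth" for f n
  proof -
    from elem_smooth_deriv[OF f] have "continuous_on {0..1} f"
      by (meson DERIV_isCont continuous_at_imp_continuous_on)
    then show ?thesis
      by (intro weak_derivative_coordinate[OF weak test_function_bump_times[OF f]] deriv h'_cont gint
          continuous_intros bump_continuous) auto
  qed
  let ?\<kappa> = "\<integral>t. bump t * t \<partial>?M"
  have le: "?\<kappa> \<le> (\<integral>t. cmod (g t n) \<partial>?M)" if n: "n > 0" for n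
  proof -
    let ?e = "\<lambda>t. cnj (cis (4 ^ n * t))"
    \<comment> \<open>Test functions are real, so the modulated bump is split into its real and imaginary parts.\<close>
    have cis: "of_real (bump t) * ?e t * x
        = of_real (bump t * cos (4 ^ n * t)) * x - \<i> * (of_real (bump t * sin (4 ^ n * t)) * x)" for t x
      by (simp add: complex_eq_iff algebra_simps)
    note sc = elem_smooth.sin[of "4 ^ n"] elem_smooth.cos[of "4 ^ n"]
    have cont: "continuous_on {0..1} (\<lambda>t. bump t * cos (4 ^ n * t))" "continuous_on {0..1} (\<lambda>t. bump t * sin (4 ^ n * t))"
      by (intro continuous_intros bump_continuous)+
    have hint: "integrable ?M (\<lambda>t. of_real (c t) * h' n t)" if "continuous_on {0..1} c" for c
      by (intro continuous_imp_integrable_real continuous_intros that h'_cont)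
    have eint: "integrable ?M (\<lambda>t. of_real (bump t) * ?e t * g t n)"
      unfolding cis by (intro Bochner_Integration.integrable_diff integrable_mult_right gint cont)
    have demod: "of_real (bump t) * ?e t * h' n t = of_real (bump t) * (1 / 4 ^ n + \<i> * of_real t)" for t
    proof -
      have "?e t * wave t n = 1 / 2 ^ n"
        using n by (simp add: wave_def cis_cnj cis_mult)
      moreover have "?e t * h' n t = 2 ^ n * (?e t * wave t n / 4 ^ n + of_real t * \<i> * (?e t * wave t n))"
        using n by (simp add: h'_def sol'_def e0_def algebra_simps)
      ultimately have "?e t * h' n t = 1 / 4 ^ n + \<i> * of_real t"
        by (simp only:) (simp add: distrib_left)
      then show ?thesis by (simp only: mult.assoc)
    qed
    have "(\<integral>t. of_real (bump t) * ?e t * g t n \<partial>?M) = (\<integral>t. of_real (bump t) * ?e t * h' n t \<partial>?M)"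
      unfolding cis using parts[OF sc(1)] parts[OF sc(2)] gint[OF cont(1)] gint[OF cont(2)] hint[OF cont(1)] hint[OF cont(2)]
      by (simp del: of_real_mult)
    also have "\<dots> = (\<integral>t. of_real (bump t) * (1 / 4 ^ n + \<i> * of_real t) \<partial>?M)"
      by (simp only: demod)
    finally have eq: "(\<integral>t. of_real (bump t) * ?e t * g t n \<partial>?M)
      = (\<integral>t. of_real (bump t) * (1 / 4 ^ n + \<i> * of_real t) \<partial>?M)" .
    have int: "integrable ?M (\<lambda>t. of_real (bump t) * (1 / 4 ^ n + \<i> * of_real t))"
      by (intro continuous_imp_integrable_real continuous_intros bump_continuous)
    have inv4: "1 / 4 ^ n = complex_of_real (1 / 4 ^ n)" by simp
    have "?\<kappa> = (\<integral>t. Im (of_real (bump t) * (1 / 4 ^ n + \<i> * of_real t)) \<partial>?M)"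
      by (intro Bochner_Integration.integral_cong refl)
         (simp only: inv4 times_complex.sel plus_complex.sel Re_complex_of_real Im_complex_of_real imaginary_unit.sel, simp)
    also have "\<dots> = Im (\<integral>t. of_real (bump t) * ?e t * g t n \<partial>?M)"
      using integral_Im[OF int] eq by simp
    also have "\<dots> \<le> cmod (\<integral>t. of_real (bump t) * ?e t * g t n \<partial>?M)"
      by (rule order_trans[OF abs_ge_self abs_Im_le_cmod])
    also have "\<dots> \<le> (\<integral>t. cmod (of_real (bump t) * ?e t * g t n) \<partial>?M)"
      by (rule integral_norm_bound)
    also have "\<dots> \<le> (\<integral>t. cmod (g t n) \<partial>?M)"
    proof (rule integral_mono)
      show "cmod (of_real (bump t) * ?e t * g t n) \<le> cmod (g t n)" for t
        using bump_le_1[of t] bump_nonneg[of t] by (simp add: norm_mult mult_left_le_one_le)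
    qed (intro integrable_norm eint coordinates_integral_tendsto_0(1)[OF g])+
    finally show ?thesis .
  qed
  have "?\<kappa> \<le> 0"
    using coordinates_integral_tendsto_0(2)[OF g] by (rule LIMSEQ_le_const) (use le in \<open>auto intro!: exI[of _ 1]\<close>)
  then show False using integral_bump_pos by simp
qed

theorem mainTheorem1:
  shows "\<exists>(K :: complex set) (V :: (nat \<Rightarrow> complex) hilbert) (H :: (nat \<Rightarrow> complex) hilbert)
            (j :: (nat \<Rightarrow> complex) \<Rightarrow> (nat \<Rightarrow> complex)) (T :: real)
            (a :: real \<Rightarrow> (nat \<Rightarrow> complex) \<Rightarrow> (nat \<Rightarrow> complex) \<Rightarrow> complex).
           K \<in> {\<real>, UNIV} \<and>
           hilbert_space K V \<and> hilbert_space K H \<and> dense_embedding K V H j \<and>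
           0 < T \<and>
           nonautonomous_form K T V a \<and> coercive_form T V a \<and>
           \<not> maximal_regularity K T V H j a"
proof (intro exI conjI)
  show "\<not> maximal_regularity UNIV 1 ell2 ell2 emb form"
    unfolding maximal_regularity_def
    using sol_solves sol_not_H1 dominated_curve_L2(1)[OF dominated_rhs] by blast
qed (auto intro: hilbert_space_ell2 dense_embedding_emb nonautonomous_form_form coercive_form_form)

end
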